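(* Let $z_1,z_2\in A_1\setminus K$ and $\Gamma=z_1\otimes1+1\otimes z_2\in A_1\otimes A_1=A_2$. If $z_1$ is nilpotent and $z_2$ is semisimple, then the centralizer $C(\Gamma)$ of $\Gamma$ in $A_2$ is commutative. If either $z_1$ or $z_2$ belongs to $\Omega_0'(A_1)$, then $C(\Gamma)$ is also commutative.
   Context: $K$ is an algebraically closed field of characteristic zero. $A_n$ is the $n$-th Weyl algebra over $K$ ($A_1$ is generated by $p,q$ with $[q,p]=1$), and $A_2=A_1\otimes_K A_1$. For $A=A_1$ or $A_2$ and $z\in A$ put $ad_z(w)=[z,w]=zw-wz$ and $Ev(z)=\{\lambda\in K\mid \exists x\in A\setminus\{0\},\ ad_z(x)=\lambda x\}$, $F(z)=\{x\in A\mid \dim_K K[ad_z](x)<\infty\}$, $N(z)=\{x\in A\mid \exists m,\ ad_z^m(x)=0\}$, $C(z)=\{x\in A\mid ad_z(x)=0\}$, $D(z)=\bigoplus_{\lambda\in Ev(z)}\{x\in A\mid ad_z(x)=\lambda x\}$. Types: if $Ev(z)=\{0\}$, $z\in\Omega_0'(A)$ if $C(z)=F(z)\subsetneq A$; $z\in\Omega_1(A)$ if $C(z)\subsetneq N(z)=A$; $z\in\Omega_1'(A)$ if $C(z)\subsetneq N(z)\subsetneq A$. If $Ev(z)\supsetneq\{0\}$, $z\in\Omega_2(A)$ if $D(z)=F(z)=A$; $z\in\Omega_2'(A)$ if $D(z)=F(z)\subsetneq A$. Nilpotent means in $\Omega_1(A)\cup\Omega_1'(A)$; semisimple means in $\Omega_2(A)\cup\Omega_2'(A)$.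 *)

theory Defs
  imports "HOL-Library.Poly_Mapping" "HOL-Computational_Algebra.Polynomial"
begin

section \<open>Finitely supported functions\<close>

lemma poly_mapping_additive_induct [case_names zero single add]:
  fixes f :: "'a \<Rightarrow>\<^sub>0 'b::comm_monoid_add"
  assumes zero: "Q 0"
    and single: "\<And>k c. Q (Poly_Mapping.single k c)"
    and add: "\<And>g h. Q g \<Longrightarrow> Q h \<Longrightarrow> Q (g + h)"
  shows "Q f"
proof (induction f rule: update_induct)
  case const
  show ?case by (rule zero)
next
  case (update f a b)
  have "Poly_Mapping.update a b f = f + Poly_Mapping.single a b"
    using update(1) by (intro poly_mapping_eqI)
      (auto simp: lookup_update lookup_add lookup_single in_keys_iff)
  then show ?case using add[OF update(3) single] by simp
qed

definition linear_extension ::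
    "('k::zero \<Rightarrow> 'b \<Rightarrow> 'b::comm_monoid_add) \<Rightarrow> ('a \<Rightarrow> 'b) \<Rightarrow> ('a \<Rightarrow>\<^sub>0 'k) \<Rightarrow> 'b"
  where "linear_extension s \<phi> u = (\<Sum>k\<in>Poly_Mapping.keys u. s (Poly_Mapping.lookup u k) (\<phi> k))"

lemma (in module) linear_extension_single:
  "linear_extension scale \<phi> (Poly_Mapping.single k c) = scale c (\<phi> k)"
  by (cases "c = 0") (auto simp: linear_extension_def)

lemma (in module) linear_extension_zero: "linear_extension scale \<phi> 0 = 0"
  by (simp add: linear_extension_def)

lemma (in module) linear_extension_add:
  "linear_extension scale \<phi> (u + v) = linear_extension scale \<phi> u + linear_extension scale \<phi> v"
proof -
  have *: "linear_extension scale \<phi> w = (\<Sum>k\<in>Poly_Mapping.keys u \<union> Poly_Mapping.keys v. scale (Poly_Mapping.lookup w k) (\<phi> k))"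
    if "Poly_Mapping.keys w \<subseteq> Poly_Mapping.keys u \<union> Poly_Mapping.keys v" for w
    unfolding linear_extension_def using that
    by (intro sum.mono_neutral_left) (auto simp: in_keys_iff)
  show ?thesis
    by (simp add: * keys_add lookup_add scale_left_distrib sum.distrib)
qed

lemma (in module) linear_extension_diff:
  "linear_extension scale \<phi> (u - v) = linear_extension scale \<phi> u - linear_extension scale \<phi> v"
  using linear_extension_add[of \<phi> "u - v" v] by simp

section \<open>The first Weyl algebra\<close>

text \<open>
  \<open>A\<^sub>1\<close> is the free associative algebra on two letters modulo the two-sided ideal
  generated by \<open>q p - p q - 1\<close>.  The free algebra is the monoid algebra of the word monoid.
  Concatenation is written additively because \<open>Poly_Mapping\<close> builds the algebra of an
  additively written (not necessarily commutative) monoid.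
\<close>

datatype letter = Letter_p | Letter_q

datatype word = Word "letter list"

instantiation word :: monoid_add
begin

definition zero_word :: word where "zero_word = Word []"

fun plus_word :: "word \<Rightarrow> word \<Rightarrow> word" where "Word u + Word v = Word (u @ v)"

instance
proof
  fix a b c :: word
  show "a + b + c = a + (b + c)" by (cases a; cases b; cases c) simp
  show "0 + a = a" and "a + 0 = a" by (cases a; simp add: zero_word_def)+
qed

end

definition free_letter :: "letter \<Rightarrow> (word \<Rightarrow>\<^sub>0 'k::field)"
  where "free_letter x = Poly_Mapping.single (Word [x]) 1"

definition weyl_relator :: "word \<Rightarrow>\<^sub>0 'k::field"
  where "weyl_relator =
    free_letter Letter_q * free_letter Letter_p - free_letter Letter_p * free_letter Letter_q - 1"

inductive_set weyl_ideal :: "(word \<Rightarrow>\<^sub>0 'k::field) set" where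
  zero: "0 \<in> weyl_ideal"
| relator: "u * weyl_relator * v \<in> weyl_ideal"
| add: "x \<in> weyl_ideal \<Longrightarrow> y \<in> weyl_ideal \<Longrightarrow> x + y \<in> weyl_ideal"

lemma weyl_ideal_mult_left: "x \<in> weyl_ideal \<Longrightarrow> a * x \<in> weyl_ideal"
proof (induction rule: weyl_ideal.induct)
  case (relator u v)
  then show ?case using weyl_ideal.relator[of "a * u" v] by (simp add: mult.assoc)
qed (auto intro: weyl_ideal.intros simp: distrib_left)

lemma weyl_ideal_mult_right: "x \<in> weyl_ideal \<Longrightarrow> x * a \<in> weyl_ideal"
proof (induction rule: weyl_ideal.induct)
  case (relator u v)
  then show ?case using weyl_ideal.relator[of u "v * a"] by (simp add: mult.assoc)
qed (auto intro: weyl_ideal.intros simp: distrib_right)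

lemma weyl_ideal_uminus: "x \<in> weyl_ideal \<Longrightarrow> - x \<in> weyl_ideal"
  using weyl_ideal_mult_left[of x "- 1"] by simp

definition weyl_cong :: "(word \<Rightarrow>\<^sub>0 'k::field) \<Rightarrow> (word \<Rightarrow>\<^sub>0 'k) \<Rightarrow> bool"
  where "weyl_cong x y \<longleftrightarrow> x - y \<in> weyl_ideal"

lemma weyl_cong_equivp: "equivp weyl_cong"
proof (rule equivpI)
  show "reflp weyl_cong" by (simp add: reflp_def weyl_cong_def weyl_ideal.zero)
  show "symp weyl_cong"
    unfolding symp_def weyl_cong_def using weyl_ideal_uminus by fastforce
  show "transp weyl_cong"
    unfolding transp_def weyl_cong_def using weyl_ideal.add by fastforce
qed

quotient_type (overloaded) 'k weyl1 = "word \<Rightarrow>\<^sub>0 'k::field" / weyl_cong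
  by (rule weyl_cong_equivp)

text \<open>
  The action on \<open>K[x]\<close>, with \<open>p\<close> acting as multiplication by \<open>x\<close> and \<open>q\<close> as \<open>d/dx\<close>,
  is used only to see that \<open>1 \<noteq> 0\<close> in \<open>A\<^sub>1\<close>.
\<close>

fun letter_action :: "letter \<Rightarrow> 'k::field poly \<Rightarrow> 'k poly" where
  "letter_action Letter_p f = pCons 0 f"
| "letter_action Letter_q f = pderiv f"

fun word_action :: "word \<Rightarrow> 'k::field poly \<Rightarrow> 'k poly" where
  "word_action (Word u) f = foldr letter_action u f"

definition free_action :: "(word \<Rightarrow>\<^sub>0 'k::field) \<Rightarrow> 'k poly \<Rightarrow> 'k poly"
  where "free_action u f = linear_extension smult (\<lambda>w. word_action w f) u"

lemma module_smult: "module (smult :: 'k::field \<Rightarrow> _)"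
  by standard (auto simp: smult_add_right smult_add_left)

lemmas free_action_simps =
  module.linear_extension_single[OF module_smult, where \<phi> = "\<lambda>w. word_action w f" for f,
    folded free_action_def]
  module.linear_extension_zero[OF module_smult, where \<phi> = "\<lambda>w. word_action w f" for f,
    folded free_action_def]
  module.linear_extension_add[OF module_smult, where \<phi> = "\<lambda>w. word_action w f" for f,
    folded free_action_def]
  module.linear_extension_diff[OF module_smult, where \<phi> = "\<lambda>w. word_action w f" for f,
    folded free_action_def]

lemma word_action_add: "word_action w (f + g) = word_action w f + word_action w g"
proof (cases w)
  case (Word u)
  have "letter_action x (f + g) = letter_action x f + letter_action x g" for x and f g :: "'a poly"
    by (cases x) (auto simp: pderiv_add)
  then have "foldr letter_action u (f + g) = foldr letter_action u f + foldr letter_action u g"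
    by (induction u) auto
  then show ?thesis using Word by simp
qed

lemma word_action_smult: "word_action w (smult c f) = smult c (word_action w f)"
proof (cases w)
  case (Word u)
  have "letter_action x (smult c f) = smult c (letter_action x f)" for x and f :: "'a poly"
    by (cases x) (auto simp: pderiv_smult)
  then have "foldr letter_action u (smult c f) = smult c (foldr letter_action u f)"
    by (induction u) auto
  then show ?thesis using Word by simp
qed

lemma word_action_zero: "word_action w 0 = 0"
  using word_action_smult[of w 0 0] by simp

lemma word_action_mult: "word_action (v + w) f = word_action v (word_action w f)"
  by (cases v; cases w) simp

lemma free_action_add_right: "free_action u (f + g) = free_action u f + free_action u g"
  by (simp add: free_action_def linear_extension_def word_action_add smult_add_right sum.distrib)

lemma free_action_zero_right: "free_action u 0 = 0"
  by (simp add: free_action_def linear_extension_def word_action_zero)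

lemma free_action_mult: "free_action (u * v) f = free_action u (free_action v f)"
proof (induction u rule: poly_mapping_additive_induct)
  case (single k c)
  show ?case
    by (induction v rule: poly_mapping_additive_induct)
      (simp_all add: free_action_simps free_action_add_right free_action_zero_right mult_single
        distrib_left word_action_mult word_action_smult word_action_add word_action_zero
        smult_add_right)
qed (simp_all add: free_action_simps distrib_right)

lemma free_action_one: "free_action 1 f = f"
  by (simp add: free_action_simps zero_word_def flip: single_one)

lemma free_action_relator: "free_action weyl_relator f = 0"
  by (simp add: weyl_relator_def free_letter_def free_action_simps mult_single free_action_one
      pderiv_pCons)

lemma free_action_ideal: "x \<in> weyl_ideal \<Longrightarrow> free_action x f = 0"
  by (induction rule: weyl_ideal.induct)
    (simp_all add: free_action_simps free_action_mult free_action_relator free_action_zero_right)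

instantiation weyl1 :: (field) ring_1
begin

lift_definition zero_weyl1 :: "'a weyl1" is 0 .

lift_definition one_weyl1 :: "'a weyl1" is 1 .

lift_definition plus_weyl1 :: "'a weyl1 \<Rightarrow> 'a weyl1 \<Rightarrow> 'a weyl1" is "(+)"
  unfolding weyl_cong_def by (metis add_diff_add weyl_ideal.add)

lift_definition uminus_weyl1 :: "'a weyl1 \<Rightarrow> 'a weyl1" is uminus
  unfolding weyl_cong_def using weyl_ideal_uminus by fastforce

lift_definition minus_weyl1 :: "'a weyl1 \<Rightarrow> 'a weyl1 \<Rightarrow> 'a weyl1" is "(-)"
  unfolding weyl_cong_def
proof -
  fix x x' y y' :: "word \<Rightarrow>\<^sub>0 'a"
  assume "x - x' \<in> weyl_ideal" "y - y' \<in> weyl_ideal"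
  then have "(x - x') + - (y - y') \<in> weyl_ideal" by (intro weyl_ideal.add weyl_ideal_uminus)
  then show "x - y - (x' - y') \<in> weyl_ideal" by (simp add: algebra_simps)
qed

lift_definition times_weyl1 :: "'a weyl1 \<Rightarrow> 'a weyl1 \<Rightarrow> 'a weyl1" is "(*)"
  unfolding weyl_cong_def
proof -
  fix x x' y y' :: "word \<Rightarrow>\<^sub>0 'a"
  assume "x - x' \<in> weyl_ideal" "y - y' \<in> weyl_ideal"
  then have "x * (y - y') + (x - x') * y' \<in> weyl_ideal"
    by (intro weyl_ideal.add weyl_ideal_mult_left weyl_ideal_mult_right)
  then show "x * y - x' * y' \<in> weyl_ideal" by (simp add: algebra_simps)
qed

instance
proof
  show "(0 :: 'a weyl1) \<noteq> 1"
  proof (transfer, unfold weyl_cong_def, rule notI)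
    assume "(0 :: word \<Rightarrow>\<^sub>0 'a) - 1 \<in> weyl_ideal"
    then have "(1 :: word \<Rightarrow>\<^sub>0 'a) \<in> weyl_ideal"
      using weyl_ideal_uminus by fastforce
    from free_action_ideal[OF this, of 1] show False
      by (simp add: free_action_simps free_action_one)
  qed
qed (transfer; simp add: algebra_simps weyl_cong_def weyl_ideal.zero)+

end

lift_definition weyl_p :: "'k::field weyl1" is "free_letter Letter_p" .

lift_definition weyl_q :: "'k::field weyl1" is "free_letter Letter_q" .

lift_definition weyl_scalar :: "'k::field \<Rightarrow> 'k weyl1" is "Poly_Mapping.single 0" .

definition weyl_scale :: "'k::field \<Rightarrow> 'k weyl1 \<Rightarrow> 'k weyl1"
  where "weyl_scale c x = weyl_scalar c * x"

lemma weyl_relation: "weyl_q * weyl_p - weyl_p * weyl_q = 1"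
proof (transfer, unfold weyl_cong_def)
  show "free_letter Letter_q * free_letter Letter_p - free_letter Letter_p * free_letter Letter_q - 1
      \<in> (weyl_ideal :: (word \<Rightarrow>\<^sub>0 'k::field) set)"
    using weyl_ideal.relator[of 1 1] by (simp add: weyl_relator_def)
qed

lemma weyl_scalar_central: "weyl_scalar c * x = x * weyl_scalar c"
proof (transfer, unfold weyl_cong_def)
  fix c :: "'k::field" and x :: "word \<Rightarrow>\<^sub>0 'k"
  have "Poly_Mapping.single 0 c * x = x * Poly_Mapping.single 0 c"
    by (induction x rule: poly_mapping_additive_induct)
      (simp_all add: mult_single distrib_left distrib_right mult.commute)
  then show "Poly_Mapping.single 0 c * x - x * Poly_Mapping.single 0 c \<in> weyl_ideal"
    by (simp add: weyl_ideal.zero)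
qed

lemma weyl_scalar_add: "weyl_scalar (a + b) = weyl_scalar a + weyl_scalar b"
  by transfer (simp add: single_add weyl_cong_def weyl_ideal.zero)

lemma weyl_scalar_mult: "weyl_scalar (a * b) = weyl_scalar a * weyl_scalar b"
  by transfer (simp add: mult_single weyl_cong_def weyl_ideal.zero)

lemma weyl_scalar_one: "weyl_scalar 1 = 1"
  by transfer (simp add: weyl_cong_def weyl_ideal.zero)

interpretation weyl1: vector_space weyl_scale
  by standard (simp_all add: weyl_scale_def algebra_simps weyl_scalar_add weyl_scalar_mult
      weyl_scalar_one)

lemma weyl_scale_mult_left: "weyl_scale c x * y = weyl_scale c (x * y)"
  by (simp add: weyl_scale_def mult.assoc)

lemma weyl_scale_mult_right: "x * weyl_scale c y = weyl_scale c (x * y)"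
  by (metis weyl_scale_def weyl_scalar_central mult.assoc)

section \<open>The second Weyl algebra as a tensor product\<close>

text \<open>
  \<open>A\<^sub>1 \<otimes>\<^sub>K A\<^sub>1\<close> is the free vector space on the set \<open>A\<^sub>1 \<times> A\<^sub>1\<close> modulo the subspace spanned by
  the bilinearity relators.  Its product is induced by \<open>(a, b) (a', b') = (a a', b b')\<close>, which
  is written additively below for the same reason as for words; in particular the neutral
  element \<open>0\<close> of the type \<open>pairs\<close> is \<open>(1, 1)\<close>.
\<close>

datatype 'a pairs = Pair1 'a 'a

instantiation pairs :: (monoid_mult) monoid_add
begin

definition zero_pairs :: "'a pairs" where "zero_pairs = Pair1 1 1"

fun plus_pairs :: "'a pairs \<Rightarrow> 'a pairs \<Rightarrow> 'a pairs" where
  "Pair1 a b + Pair1 a' b' = Pair1 (a * a') (b * b')"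

instance
proof
  fix a b c :: "'a pairs"
  show "a + b + c = a + (b + c)" by (cases a; cases b; cases c) (simp add: mult.assoc)
  show "0 + a = a" and "a + 0 = a" by (cases a; simp add: zero_pairs_def)+
qed

end

abbreviation pair_vec :: "'k::field weyl1 \<Rightarrow> 'k weyl1 \<Rightarrow> 'k \<Rightarrow> ('k weyl1 pairs \<Rightarrow>\<^sub>0 'k)"
  where "pair_vec a b c \<equiv> Poly_Mapping.single (Pair1 a b) c"

inductive_set tensor_null :: "('k::field weyl1 pairs \<Rightarrow>\<^sub>0 'k) set" where
  zero: "0 \<in> tensor_null"
| add: "x \<in> tensor_null \<Longrightarrow> y \<in> tensor_null \<Longrightarrow> x + y \<in> tensor_null"
| add_left: "pair_vec (a + a') b c - pair_vec a b c - pair_vec a' b c \<in> tensor_null"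
| add_right: "pair_vec a (b + b') c - pair_vec a b c - pair_vec a b' c \<in> tensor_null"
| scale_left: "pair_vec (weyl_scale d a) b c - pair_vec a b (c * d) \<in> tensor_null"
| scale_right: "pair_vec a (weyl_scale d b) c - pair_vec a b (c * d) \<in> tensor_null"

lemma tensor_null_mult_left: "x \<in> tensor_null \<Longrightarrow> u * x \<in> tensor_null"
proof (induction u rule: poly_mapping_additive_induct)
  case zero
  show ?case by (simp add: tensor_null.zero)
next
  case (add g h)
  then show ?case by (simp add: distrib_right tensor_null.add)
next
  case (single k e)
  obtain r s where k: "k = Pair1 r s" by (cases k)
  from single show ?case
  proof (induction rule: tensor_null.induct)
    case zero
    show ?case by (simp add: tensor_null.zero)
  next
    case (add x y)
    then show ?case by (simp add: distrib_left tensor_null.add)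
  qed (auto simp: k right_diff_distrib mult_single distrib_left weyl_scale_mult_right
      mult.assoc[symmetric] intro: tensor_null.intros)
qed

lemma tensor_null_mult_right: "x \<in> tensor_null \<Longrightarrow> x * u \<in> tensor_null"
proof (induction u rule: poly_mapping_additive_induct)
  case zero
  show ?case by (simp add: tensor_null.zero)
next
  case (add g h)
  then show ?case by (simp add: distrib_left tensor_null.add)
next
  case (single k e)
  obtain r s where k: "k = Pair1 r s" by (cases k)
  have swap: "c * d * e = c * e * d" for c d :: 'a by (simp add: mult_ac)
  from single show ?case
  proof (induction rule: tensor_null.induct)
    case zero
    show ?case by (simp add: tensor_null.zero)
  next
    case (add x y)
    then show ?case by (simp add: distrib_right tensor_null.add)
  qed (auto simp: k left_diff_distrib mult_single distrib_right weyl_scale_mult_left swap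
      intro: tensor_null.intros)
qed

lemma tensor_null_uminus: "x \<in> tensor_null \<Longrightarrow> - x \<in> tensor_null"
  using tensor_null_mult_left[of x "- 1"] by simp

definition tensor_cong :: "('k::field weyl1 pairs \<Rightarrow>\<^sub>0 'k) \<Rightarrow> ('k weyl1 pairs \<Rightarrow>\<^sub>0 'k) \<Rightarrow> bool"
  where "tensor_cong x y \<longleftrightarrow> x - y \<in> tensor_null"

lemma tensor_cong_equivp: "equivp tensor_cong"
proof (rule equivpI)
  show "reflp tensor_cong" by (simp add: reflp_def tensor_cong_def tensor_null.zero)
  show "symp tensor_cong"
    unfolding symp_def tensor_cong_def using tensor_null_uminus by fastforce
  show "transp tensor_cong"
    unfolding transp_def tensor_cong_def using tensor_null.add by fastforce
qed

quotient_type (overloaded) 'k weyl2 = "'k weyl1 pairs \<Rightarrow>\<^sub>0 'k::field" / tensor_cong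
  by (rule tensor_cong_equivp)

text \<open>
  The following functionals are used only to see that \<open>1 \<noteq> 0\<close> in \<open>A\<^sub>1 \<otimes> A\<^sub>1\<close>.
\<close>

lift_definition weyl_functional :: "'k::field weyl1 \<Rightarrow> 'k" is "\<lambda>u. coeff (free_action u 1) 0"
  unfolding weyl_cong_def
  by (metis free_action_ideal free_action_simps(4) eq_iff_diff_eq_0)

lemma weyl_functional_add: "weyl_functional (x + y) = weyl_functional x + weyl_functional y"
  by transfer (simp add: free_action_simps)

lemma weyl_functional_one: "weyl_functional 1 = 1"
  by transfer (simp add: free_action_one)

lemma weyl_functional_scale: "weyl_functional (weyl_scale c x) = c * weyl_functional x"
  unfolding weyl_scale_def
  by transfer (simp add: free_action_mult free_action_simps zero_word_def)

fun pair_functional :: "'k::field weyl1 pairs \<Rightarrow> 'k" where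
  "pair_functional (Pair1 a b) = weyl_functional a * weyl_functional b"

lemma module_times: "module ((*) :: 'k::field \<Rightarrow> _)"
  by standard (auto simp: algebra_simps)

lemmas tensor_functional_simps =
  module.linear_extension_single[OF module_times]
  module.linear_extension_zero[OF module_times]
  module.linear_extension_add[OF module_times]
  module.linear_extension_diff[OF module_times]

lemma tensor_functional_null:
  "x \<in> tensor_null \<Longrightarrow> linear_extension (*) pair_functional x = 0"
  by (induction rule: tensor_null.induct)
    (simp_all add: tensor_functional_simps weyl_functional_add weyl_functional_scale algebra_simps)

instantiation weyl2 :: (field) ring_1
begin

lift_definition zero_weyl2 :: "'a weyl2" is 0 .

lift_definition one_weyl2 :: "'a weyl2" is 1 .

lift_definition plus_weyl2 :: "'a weyl2 \<Rightarrow> 'a weyl2 \<Rightarrow> 'a weyl2" is "(+)"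
  unfolding tensor_cong_def by (metis add_diff_add tensor_null.add)

lift_definition uminus_weyl2 :: "'a weyl2 \<Rightarrow> 'a weyl2" is uminus
  unfolding tensor_cong_def using tensor_null_uminus by fastforce

lift_definition minus_weyl2 :: "'a weyl2 \<Rightarrow> 'a weyl2 \<Rightarrow> 'a weyl2" is "(-)"
  unfolding tensor_cong_def
proof -
  fix x x' y y' :: "'a weyl1 pairs \<Rightarrow>\<^sub>0 'a"
  assume "x - x' \<in> tensor_null" "y - y' \<in> tensor_null"
  then have "(x - x') + - (y - y') \<in> tensor_null" by (intro tensor_null.add tensor_null_uminus)
  then show "x - y - (x' - y') \<in> tensor_null" by (simp add: algebra_simps)
qed

lift_definition times_weyl2 :: "'a weyl2 \<Rightarrow> 'a weyl2 \<Rightarrow> 'a weyl2" is "(*)"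
  unfolding tensor_cong_def
proof -
  fix x x' y y' :: "'a weyl1 pairs \<Rightarrow>\<^sub>0 'a"
  assume "x - x' \<in> tensor_null" "y - y' \<in> tensor_null"
  then have "x * (y - y') + (x - x') * y' \<in> tensor_null"
    by (intro tensor_null.add tensor_null_mult_left tensor_null_mult_right)
  then show "x * y - x' * y' \<in> tensor_null" by (simp add: algebra_simps)
qed

instance
proof
  show "(0 :: 'a weyl2) \<noteq> 1"
  proof (transfer, unfold tensor_cong_def, rule notI)
    assume "(0 :: 'a weyl1 pairs \<Rightarrow>\<^sub>0 'a) - 1 \<in> tensor_null"
    then have "(1 :: 'a weyl1 pairs \<Rightarrow>\<^sub>0 'a) \<in> tensor_null"
      using tensor_null_uminus by fastforce
    from tensor_functional_null[OF this] show False
      by (simp add: tensor_functional_simps zero_pairs_def weyl_functional_one flip: single_one)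
  qed
qed (transfer; simp add: algebra_simps tensor_cong_def tensor_null.zero)+

end

lift_definition tensor :: "'k::field weyl1 \<Rightarrow> 'k weyl1 \<Rightarrow> 'k weyl2" (infixl \<open>\<otimes>\<close> 75)
  is "\<lambda>a b. pair_vec a b 1" .

lemma tensor_add_left: "(a + a') \<otimes> b = a \<otimes> b + a' \<otimes> b"
  by transfer (metis tensor_cong_def tensor_null.add_left diff_diff_eq)

lemma tensor_add_right: "a \<otimes> (b + b') = a \<otimes> b + a \<otimes> b'"
  by transfer (metis tensor_cong_def tensor_null.add_right diff_diff_eq)

lemma tensor_scale: "weyl_scale c a \<otimes> b = a \<otimes> weyl_scale c b"
proof (transfer, unfold tensor_cong_def)
  fix c :: "'k::field" and a b :: "'k weyl1"
  have "(pair_vec (weyl_scale c a) b 1 - pair_vec a b (1 * c))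
      + - (pair_vec a (weyl_scale c b) 1 - pair_vec a b (1 * c)) \<in> tensor_null"
    by (intro tensor_null.add tensor_null_uminus tensor_null.scale_left tensor_null.scale_right)
  then show "pair_vec (weyl_scale c a) b 1 - pair_vec a (weyl_scale c b) 1 \<in> tensor_null"
    by simp
qed

lemma tensor_mult: "(a \<otimes> b) * (a' \<otimes> b') = (a * a') \<otimes> (b * b')"
  by transfer (simp add: mult_single tensor_cong_def tensor_null.zero)

lemma tensor_one: "1 \<otimes> 1 = 1"
  by transfer (simp add: tensor_cong_def tensor_null.zero zero_pairs_def flip: single_one)

section \<open>Adjoint actions and types\<close>

text \<open>
  The parameter \<open>s\<close> is the scalar multiplication of the algebra, and the whole type \<open>'a\<close> is
  its carrier.  \<open>ad_orbit s z x\<close> is \<open>K[ad\<^sub>z](x)\<close>, the set of all \<open>f(ad\<^sub>z)(x)\<close> with \<open>f \<in> K[t]\<close>.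
\<close>

definition ad :: "'a::ring_1 \<Rightarrow> 'a \<Rightarrow> 'a"
  where "ad z w = z * w - w * z"

definition ad_eigenspace :: "('k::field \<Rightarrow> 'a \<Rightarrow> 'a) \<Rightarrow> 'a::ring_1 \<Rightarrow> 'k \<Rightarrow> 'a set"
  where "ad_eigenspace s z l = {x. ad z x = s l x}"

definition ad_Ev :: "('k::field \<Rightarrow> 'a \<Rightarrow> 'a) \<Rightarrow> 'a::ring_1 \<Rightarrow> 'k set"
  where "ad_Ev s z = {l. \<exists>x. x \<noteq> 0 \<and> ad z x = s l x}"

definition ad_orbit :: "('k::field \<Rightarrow> 'a \<Rightarrow> 'a) \<Rightarrow> 'a::ring_1 \<Rightarrow> 'a \<Rightarrow> 'a set"
  where "ad_orbit s z x = {\<Sum>i\<le>degree f. s (coeff f i) ((ad z ^^ i) x) | f. True}"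

definition ad_F :: "('k::field \<Rightarrow> 'a \<Rightarrow> 'a) \<Rightarrow> 'a::ring_1 \<Rightarrow> 'a set"
  where "ad_F s z = {x. \<exists>B. finite B \<and> ad_orbit s z x \<subseteq> module.span s B}"

definition ad_N :: "'a::ring_1 \<Rightarrow> 'a set"
  where "ad_N z = {x. \<exists>m. (ad z ^^ m) x = 0}"

definition ad_C :: "'a::ring_1 \<Rightarrow> 'a set"
  where "ad_C z = {x. ad z x = 0}"

text \<open>Eigenspaces for distinct eigenvalues are independent, so their sum is direct.\<close>

definition ad_D :: "('k::field \<Rightarrow> 'a \<Rightarrow> 'a) \<Rightarrow> 'a::ring_1 \<Rightarrow> 'a set"
  where "ad_D s z = module.span s (\<Union>l\<in>ad_Ev s z. ad_eigenspace s z l)"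

definition Omega0' :: "('k::field \<Rightarrow> 'a \<Rightarrow> 'a) \<Rightarrow> 'a::ring_1 set"
  where "Omega0' s = {z. ad_Ev s z = {0} \<and> ad_C z = ad_F s z \<and> ad_F s z \<subset> UNIV}"

definition Omega1 :: "('k::field \<Rightarrow> 'a \<Rightarrow> 'a) \<Rightarrow> 'a::ring_1 set"
  where "Omega1 s = {z. ad_Ev s z = {0} \<and> ad_C z \<subset> ad_N z \<and> ad_N z = UNIV}"

definition Omega1' :: "('k::field \<Rightarrow> 'a \<Rightarrow> 'a) \<Rightarrow> 'a::ring_1 set"
  where "Omega1' s = {z. ad_Ev s z = {0} \<and> ad_C z \<subset> ad_N z \<and> ad_N z \<subset> UNIV}"

definition Omega2 :: "('k::field \<Rightarrow> 'a \<Rightarrow> 'a) \<Rightarrow> 'a::ring_1 set"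
  where "Omega2 s = {z. {0} \<subset> ad_Ev s z \<and> ad_D s z = ad_F s z \<and> ad_F s z = UNIV}"

definition Omega2' :: "('k::field \<Rightarrow> 'a \<Rightarrow> 'a) \<Rightarrow> 'a::ring_1 set"
  where "Omega2' s = {z. {0} \<subset> ad_Ev s z \<and> ad_D s z = ad_F s z \<and> ad_F s z \<subset> UNIV}"

definition ad_nilpotent :: "('k::field \<Rightarrow> 'a \<Rightarrow> 'a) \<Rightarrow> 'a::ring_1 \<Rightarrow> bool"
  where "ad_nilpotent s z \<longleftrightarrow> z \<in> Omega1 s \<union> Omega1' s"

definition ad_semisimple :: "('k::field \<Rightarrow> 'a \<Rightarrow> 'a) \<Rightarrow> 'a::ring_1 \<Rightarrow> bool"
  where "ad_semisimple s z \<longleftrightarrow> z \<in> Omega2 s \<union> Omega2' s"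

end

theory Submission
  imports Defs
begin

text \<open>
  Write \<open>w \<in> C(\<Gamma>)\<close> as \<open>\<Sum> x\<^sub>i \<otimes> y\<^sub>i\<close> with both families linearly independent.
  The relation \<open>\<Sum> [z\<^sub>1, x\<^sub>i] \<otimes> y\<^sub>i = - \<Sum> x\<^sub>i \<otimes> [z\<^sub>2, y\<^sub>i]\<close> shows that the spans of the two
  families are stable, so \<open>x\<^sub>i \<in> F(z\<^sub>1)\<close> and \<open>y\<^sub>i \<in> F(z\<^sub>2)\<close>, and that one family is centralized
  as soon as the other is.  In the second case of the statement this holds because
  \<open>F = C\<close>.  In the first case \<open>F(z\<^sub>1) = N(z\<^sub>1)\<close> because \<open>K\<close> is algebraically closed; by the relation
  nilpotency passes to the \<open>y\<^sub>i\<close>, and \<open>N(z\<^sub>2) \<inter> D(z\<^sub>2) = C(z\<^sub>2)\<close>.  Hence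
  \<open>C(\<Gamma>) = C(z\<^sub>1) \<otimes> C(z\<^sub>2)\<close>, and centralizers of nonscalar elements of \<open>A\<^sub>1\<close> are commutative.
\<close>

section \<open>Normally ordered symbols\<close>

definition weyl_of_poly :: "'k::field poly \<Rightarrow> 'k weyl1"
  where "weyl_of_poly a = fold_coeffs (\<lambda>c x. weyl_scalar c + weyl_p * x) a 0"

lemma weyl_scalar_zero [simp]: "weyl_scalar 0 = 0"
  by transfer (simp add: weyl_cong_def weyl_ideal.zero)

lemma weyl_of_poly_0 [simp]: "weyl_of_poly 0 = 0"
  by (simp add: weyl_of_poly_def)

lemma weyl_of_poly_pCons [simp]:
  "weyl_of_poly (pCons c a) = weyl_scalar c + weyl_p * weyl_of_poly a"
  by (cases "c = 0"; cases "a = 0") (simp_all add: weyl_of_poly_def)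

lemma weyl_of_poly_add: "weyl_of_poly (a + b) = weyl_of_poly a + weyl_of_poly b"
  by (induction a b rule: poly_induct2) (simp_all add: weyl_scalar_add algebra_simps)

lemma weyl_of_poly_smult: "weyl_of_poly (smult c a) = weyl_scalar c * weyl_of_poly a"
proof (induction a)
  case (pCons d a)
  then show ?case
    by (simp add: weyl_scalar_mult distrib_left) (metis mult.assoc weyl_scalar_central)
qed simp

lemma weyl_of_poly_mult: "weyl_of_poly (a * b) = weyl_of_poly a * weyl_of_poly b"
  by (induction a)
    (simp_all add: weyl_of_poly_add weyl_of_poly_smult distrib_right mult.assoc)

lemma weyl_q_mult_p: "weyl_q * weyl_p = weyl_p * weyl_q + 1"
  using weyl_relation by (simp add: algebra_simps)

text \<open>Commutation with \<open>weyl_q\<close> is a derivation sending \<open>weyl_p\<close> to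
  1, so on polynomials in \<open>weyl_p\<close> it is differentiation.\<close>

lemma weyl_q_mult_of_poly:
  "weyl_q * weyl_of_poly a = weyl_of_poly a * weyl_q + weyl_of_poly (pderiv a)"
proof (induction a)
  case (pCons c a)
  have "weyl_q * (weyl_p * weyl_of_poly a)
      = weyl_p * (weyl_q * weyl_of_poly a) + weyl_of_poly a"
    by (simp add: weyl_q_mult_p distrib_right flip: mult.assoc)
  also have "\<dots> = weyl_p * weyl_of_poly a * weyl_q + weyl_p * weyl_of_poly (pderiv a) + weyl_of_poly a"
    by (simp only: pCons.IH distrib_left mult.assoc)
  finally show ?case
    by (simp add: pderiv_pCons weyl_of_poly_add distrib_left distrib_right weyl_scalar_central[of c weyl_q]
        add_ac)
qed simp

text \<open>A polynomial in a second variable \<open>y\<close> over \<open>K[x]\<close> stands for the ordered expression with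
  \<open>p\<close> in place of \<open>x\<close> on the left and \<open>q\<close> in place of \<open>y\<close> on the right.\<close>

definition weyl_of_symbol :: "'k::field poly poly \<Rightarrow> 'k weyl1"
  where "weyl_of_symbol F = fold_coeffs (\<lambda>a x. weyl_of_poly a + x * weyl_q) F 0"

lemma weyl_of_symbol_0 [simp]: "weyl_of_symbol 0 = 0"
  by (simp add: weyl_of_symbol_def)

lemma weyl_of_symbol_pCons [simp]:
  "weyl_of_symbol (pCons a F) = weyl_of_poly a + weyl_of_symbol F * weyl_q"
  by (cases "a = 0"; cases "F = 0") (simp_all add: weyl_of_symbol_def)

lemma weyl_of_symbol_add: "weyl_of_symbol (F + G) = weyl_of_symbol F + weyl_of_symbol G"
  by (induction F G rule: poly_induct2) (simp_all add: weyl_of_poly_add algebra_simps)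

lemma weyl_of_symbol_smult: "weyl_of_symbol (smult a F) = weyl_of_poly a * weyl_of_symbol F"
  by (induction F) (simp_all add: weyl_of_poly_mult distrib_left mult.assoc)

text \<open>Left multiplication by \<open>q\<close>, read on symbols, is \<open>\<partial>/\<partial>x + y\<close>.\<close>

definition symbol_q :: "'k::field poly poly \<Rightarrow> 'k poly poly"
  where "symbol_q F = map_poly pderiv F + pCons 0 F"

lemma coeff_symbol_q: "coeff (symbol_q F) i = pderiv (coeff F i) + coeff (pCons 0 F) i"
  by (simp add: symbol_q_def coeff_map_poly)

lemma weyl_of_symbol_q: "weyl_of_symbol (symbol_q F) = weyl_q * weyl_of_symbol F"
proof -
  have "weyl_of_symbol (map_poly pderiv F) + weyl_of_symbol F * weyl_q = weyl_q * weyl_of_symbol F"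
  proof (induction F)
    case (pCons a F)
    have "weyl_q * (weyl_of_symbol F * weyl_q) = weyl_of_symbol (map_poly pderiv F) * weyl_q
        + weyl_of_symbol F * weyl_q * weyl_q"
      by (metis pCons.IH distrib_right mult.assoc)
    then show ?case
      by (simp add: map_poly_pCons weyl_q_mult_of_poly algebra_simps)
  qed simp
  then show ?thesis by (simp add: symbol_q_def weyl_of_symbol_add)
qed

text \<open>The product of \<open>A_1\<close> transported to symbols: if \<open>F\<close> has
  coefficients \<open>a_i\<close>, the sum of \<open>a_i\<close> times the \<open>i\<close>-fold
  \<open>symbol_q\<close> of \<open>G\<close>. The fold builds functions because each further power
  of \<open>y\<close> acts on the argument \<open>G\<close>.\<close>

definition star :: "'k::field poly poly \<Rightarrow> 'k poly poly \<Rightarrow> 'k poly poly"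
  where "star F = fold_coeffs (\<lambda>a h G. smult a G + h (symbol_q G)) F (\<lambda>_. 0)"

lemma star_0 [simp]: "star 0 G = 0"
  by (simp add: star_def)

lemma star_pCons [simp]: "star (pCons a F) G = smult a G + star F (symbol_q G)"
  by (cases "a = 0"; cases "F = 0") (simp_all add: star_def)

lemma weyl_of_symbol_star:
  "weyl_of_symbol (star F G) = weyl_of_symbol F * weyl_of_symbol G"
  by (induction F arbitrary: G)
    (simp_all add: weyl_of_symbol_add weyl_of_symbol_smult weyl_of_symbol_q distrib_right mult.assoc)

text \<open>Words are normally ordered by prefixing letters: a new \<open>p\<close> multiplies the
  symbol by \<open>x\<close>, a new \<open>q\<close> applies \<open>symbol_q\<close>.\<close>

lemma abs_weyl1_single:
  "abs_weyl1 (Poly_Mapping.single (Word l) c) \<in> range (weyl_of_symbol :: 'k::field poly poly \<Rightarrow> _)"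
proof (induction l)
  case Nil
  have "abs_weyl1 (Poly_Mapping.single (Word []) c) = weyl_scalar c"
    by (simp add: weyl_scalar.abs_eq zero_word_def)
  also have "\<dots> = weyl_of_symbol [:[:c:]:]" by simp
  finally show ?case by blast
next
  case (Cons x l)
  then obtain F where F: "abs_weyl1 (Poly_Mapping.single (Word l) c) = weyl_of_symbol F" by blast
  have eq: "abs_weyl1 (Poly_Mapping.single (Word (x # l)) c)
      = abs_weyl1 (free_letter x) * weyl_of_symbol F"
    by (simp add: times_weyl1.abs_eq mult_single free_letter_def flip: F)
  show ?case
  proof (cases x)
    case Letter_p
    then have "abs_weyl1 (Poly_Mapping.single (Word (x # l)) c) = weyl_of_symbol (smult [:0, 1:] F)"
      using eq by (simp add: weyl_of_symbol_smult weyl_p_def weyl_scalar_one)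
    then show ?thesis by blast
  next
    case Letter_q
    then have "abs_weyl1 (Poly_Mapping.single (Word (x # l)) c) = weyl_of_symbol (symbol_q F)"
      using eq by (simp add: weyl_of_symbol_q weyl_q_def)
    then show ?thesis by blast
  qed
qed

lemma surj_weyl_of_symbol: "surj (weyl_of_symbol :: 'k::field poly poly \<Rightarrow> _)"
proof -
  have "abs_weyl1 u \<in> range (weyl_of_symbol :: 'k poly poly \<Rightarrow> _)" for u
  proof (induction u rule: poly_mapping_additive_induct)
    case zero
    have "abs_weyl1 0 = weyl_of_symbol 0" by (simp add: zero_weyl1_def)
    then show ?case by blast
  next
    case (single w c)
    then show ?case using abs_weyl1_single by (cases w) auto
  next
    case (add g h)
    then obtain G H where "abs_weyl1 g = weyl_of_symbol G" "abs_weyl1 h = weyl_of_symbol H" by blast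
    then have "abs_weyl1 (g + h) = weyl_of_symbol (G + H)"
      by (simp add: weyl_of_symbol_add flip: plus_weyl1.abs_eq)
    then show ?case by blast
  qed
  then show ?thesis by (metis Quotient3_abs_rep Quotient3_weyl1 surjI rangeE surj_def)
qed

section \<open>Faithfulness of the action on polynomials and uniqueness of symbols\<close>

lift_definition weyl_action :: "'k::field weyl1 \<Rightarrow> 'k poly \<Rightarrow> 'k poly" is free_action
  unfolding weyl_cong_def
  by (metis ext free_action_ideal free_action_simps(4) eq_iff_diff_eq_0)

lemma weyl_action_add: "weyl_action (u + v) f = weyl_action u f + weyl_action v f"
  by transfer (simp add: free_action_simps)

lemma weyl_action_mult: "weyl_action (u * v) f = weyl_action u (weyl_action v f)"
  by transfer (simp add: free_action_mult)

lemma weyl_action_0 [simp]: "weyl_action 0 f = 0"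
  by transfer (simp add: free_action_simps)

lemma weyl_action_scalar: "weyl_action (weyl_scalar c) f = smult c f"
  by transfer (simp add: free_action_simps zero_word_def)

lemma weyl_action_p: "weyl_action weyl_p f = pCons 0 f"
  by transfer (simp add: free_action_simps free_letter_def)

lemma weyl_action_q: "weyl_action weyl_q f = pderiv f"
  by transfer (simp add: free_action_simps free_letter_def)

lemma weyl_action_of_poly: "weyl_action (weyl_of_poly a) f = a * f"
  by (induction a)
    (simp_all add: weyl_action_add weyl_action_mult weyl_action_scalar weyl_action_p)

text \<open>Integrating the leading monomial divides by \<open>Suc n\<close>, which characteristic
  zero permits; what remains has smaller degree.\<close>

lemma pderiv_surj: "\<exists>g. pderiv g = (f :: 'k::field_char_0 poly)"
proof (induction f rule: measure_induct_rule[where f = degree])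
  case (less f)
  show ?case
  proof (cases "f = 0")
    case True
    then show ?thesis by (intro exI[of _ 0]) simp
  next
    case False
    define n where "n = degree f"
    define g where "g = monom (lead_coeff f / of_nat (Suc n)) (Suc n)"
    have g: "pderiv g = monom (lead_coeff f) n"
      by (simp add: g_def pderiv_monom del: of_nat_Suc)
    show ?thesis
    proof (cases "n = 0")
      case True
      then have "f = monom (lead_coeff f) n"
        unfolding n_def by (metis degree_0_id monom_0)
      then show ?thesis using g by metis
    next
      case n: False
      have "degree (f - monom (lead_coeff f) n) < n"
        using n unfolding n_def
        by (intro degree_lessI) (auto simp: coeff_eq_0)
      then obtain h where "pderiv h = f - monom (lead_coeff f) n"
        using less unfolding n_def by blast
      then have "pderiv (h + g) = f" using g by (simp add: pderiv_add)
      then show ?thesis by blast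
    qed
  qed
qed

text \<open>The constant term of a symbol is recovered by letting it act on \<open>1\<close>, and the higher ones by
  letting it act on antiderivatives, which exist in characteristic zero.\<close>

lemma weyl_of_symbol_eq_0D: "weyl_of_symbol (F :: 'k::field_char_0 poly poly) = 0 \<Longrightarrow> F = 0"
proof -
  assume "weyl_of_symbol F = 0"
  then have "\<forall>f. weyl_action (weyl_of_symbol F) f = 0" by simp
  then show "F = 0"
  proof (induction F)
    case (pCons a F)
    have eq: "a * f + weyl_action (weyl_of_symbol F) (pderiv f) = 0" for f
      using pCons.prems by (simp add: weyl_action_add weyl_action_mult weyl_action_of_poly weyl_action_q)
    have 0: "weyl_action u 0 = 0" for u :: "'k weyl1"
      by transfer (simp add: free_action_zero_right)
    from eq[of 1] have a: "a = 0" by (simp add: 0)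
    have "weyl_action (weyl_of_symbol F) g = 0" for g
      using eq a pderiv_surj[of g] by auto
    then show ?case using a pCons.IH by simp
  qed simp
qed

lemma inj_weyl_of_symbol: "inj (weyl_of_symbol :: 'k::field_char_0 poly poly \<Rightarrow> _)"
proof (rule injI)
  fix F G :: "'k poly poly"
  assume eq: "weyl_of_symbol F = weyl_of_symbol G"
  have "weyl_of_symbol (F - G) + weyl_of_symbol G = weyl_of_symbol F"
    by (simp flip: weyl_of_symbol_add)
  then show "F = G" using eq weyl_of_symbol_eq_0D[of "F - G"] by simp
qed

definition symbol :: "'k::field_char_0 weyl1 \<Rightarrow> 'k poly poly"
  where "symbol = inv weyl_of_symbol"

lemma weyl_of_symbol_symbol [simp]: "weyl_of_symbol (symbol u) = u"
  by (simp add: symbol_def surj_weyl_of_symbol surj_f_inv_f)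

lemma symbol_weyl_of_symbol [simp]: "symbol (weyl_of_symbol F) = F"
  by (simp add: symbol_def inj_weyl_of_symbol inv_f_f)

lemma symbol_0 [simp]: "symbol 0 = 0"
  by (metis symbol_weyl_of_symbol weyl_of_symbol_0)

lemma symbol_eq_0_iff [simp]: "symbol u = 0 \<longleftrightarrow> u = 0"
  by (metis symbol_0 weyl_of_symbol_symbol)

lemma symbol_add: "symbol (u + v) = symbol u + symbol v"
  by (metis symbol_weyl_of_symbol weyl_of_symbol_symbol weyl_of_symbol_add)

lemma symbol_mult: "symbol (u * v) = star (symbol u) (symbol v)"
  by (metis symbol_weyl_of_symbol weyl_of_symbol_symbol weyl_of_symbol_star)

lemma symbol_scalar: "symbol (weyl_scalar c) = [:[:c:]:]"
proof -
  have "weyl_of_symbol [:[:c:]:] = weyl_scalar c" by simp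
  then show ?thesis by (metis symbol_weyl_of_symbol)
qed

lemma symbol_scale: "symbol (weyl_scale c u) = smult [:c:] (symbol u)"
  by (simp add: weyl_scale_def symbol_mult symbol_scalar)

section \<open>Leading and subleading coefficients of products\<close>

lemma degree_star_le:
  "degree F \<le> n \<Longrightarrow> degree G \<le> m \<Longrightarrow> degree (star F G) \<le> n + m"
proof (induction F arbitrary: n m G)
  case (pCons a F)
  show ?case
  proof (cases n)
    case 0
    with pCons show ?thesis by (auto intro: order_trans[OF degree_smult_le] split: if_splits)
  next
    case (Suc n')
    have "degree (symbol_q G) \<le> Suc m"
      using pCons.prems(2) by (intro degree_le) (auto simp: coeff_symbol_q coeff_pCons coeff_eq_0 split: nat.split)
    moreover have "degree F \<le> n'" using pCons.prems(1) Suc by (auto split: if_splits)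
    ultimately have "degree (star F (symbol_q G)) \<le> n + m"
      using pCons.IH[of n' "symbol_q G" "Suc m"] Suc by simp
    moreover have "degree (smult a G) \<le> n + m"
      using pCons.prems(2) degree_smult_le[of a G] by linarith
    ultimately show ?thesis by (simp add: degree_add_le)
  qed
qed simp

text \<open>Multiplying by \<open>y\<close> shifts the subleading coefficients to the leading position, so that no
  truncated index \<open>n - 1\<close> occurs in the second formula.\<close>

lemma coeff_star:
  assumes "degree F \<le> n" "degree G \<le> m"
  shows "coeff (star F G) (n + m) = coeff F n * coeff G m"
    and "coeff (pCons 0 (star F G)) (n + m) = coeff F n * coeff (pCons 0 G) m
      + coeff (pCons 0 F) n * coeff G m + of_nat n * coeff F n * pderiv (coeff G m)"
proof -
  have "coeff (star F G) (n + m) = coeff F n * coeff G m \<and>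
      coeff (pCons 0 (star F G)) (n + m) = coeff F n * coeff (pCons 0 G) m
      + coeff (pCons 0 F) n * coeff G m + of_nat n * coeff F n * pderiv (coeff G m)"
    using assms
  proof (induction F arbitrary: n m G)
    case (pCons a F)
    show ?case
    proof (cases n)
      case 0
      with pCons.prems have "F = 0" by (auto split: if_splits)
      with 0 show ?thesis by (simp add: coeff_pCons split: nat.split)
    next
      case (Suc n')
      have d: "degree (symbol_q G) \<le> Suc m"
        using pCons.prems(2) by (intro degree_le) (auto simp: coeff_symbol_q coeff_pCons coeff_eq_0 split: nat.split)
      have "degree F \<le> n'" using pCons.prems(1) Suc by (auto split: if_splits)
      note IH = pCons.IH[OF this d]
      have G: "coeff G k = 0" if "k > m" for k using that pCons.prems(2) by (simp add: coeff_eq_0)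
      \<comment> \<open>Each \<open>symbol_q\<close> keeps the leading coefficient of
        \<open>G\<close> and adds its derivative to the subleading one; \<open>n\<close>
        applications give the factor \<open>of_nat n\<close>.\<close>
      have q: "coeff (symbol_q G) (Suc m) = coeff G m"
        "coeff (pCons 0 (symbol_q G)) (Suc m) = pderiv (coeff G m) + coeff (pCons 0 G) m"
        by (simp_all add: coeff_symbol_q G)
      \<comment> \<open>For \<open>n' = 0\<close> the summand \<open>smult a G\<close> still reaches
        the subleading position; for larger \<open>n'\<close> it stays below.\<close>
      show ?thesis
        using IH unfolding q Suc
        by (cases n') (simp_all add: G algebra_simps)
    qed
  qed simp
  then show "coeff (star F G) (n + m) = coeff F n * coeff G m"
    and "coeff (pCons 0 (star F G)) (n + m) = coeff F n * coeff (pCons 0 G) m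
      + coeff (pCons 0 F) n * coeff G m + of_nat n * coeff F n * pderiv (coeff G m)"
    by auto
qed

section \<open>Commutativity of centralizers in the first Weyl algebra\<close>

text \<open>\<open>K[x]\<close> has no zero divisors, so the product of the leading coefficients
  survives.\<close>

lemma star_nonzero:
  assumes "F \<noteq> 0" "G \<noteq> (0 :: 'k::field_char_0 poly poly)"
  shows "degree (star F G) = degree F + degree G"
    and "lead_coeff (star F G) = lead_coeff F * lead_coeff G"
proof -
  have c: "coeff (star F G) (degree F + degree G) = lead_coeff F * lead_coeff G"
    by (simp add: coeff_star)
  moreover have "lead_coeff F * lead_coeff G \<noteq> 0" using assms by simp
  ultimately show d: "degree (star F G) = degree F + degree G"
    using degree_star_le[of F "degree F" G "degree G"] le_degree[of "star F G" "degree F + degree G"]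
    by simp
  show "lead_coeff (star F G) = lead_coeff F * lead_coeff G"
    using c by (simp add: d)
qed

definition q_degree :: "'k::field_char_0 weyl1 \<Rightarrow> nat"
  where "q_degree u = degree (symbol u)"

text \<open>Not the degree in \<open>p\<close>: with \<open>q_degree\<close> it gives the exponents
  of the leading monomial in the lexicographic order that ranks powers of \<open>q\<close>
  first.\<close>

definition p_degree :: "'k::field_char_0 weyl1 \<Rightarrow> nat"
  where "p_degree u = degree (lead_coeff (symbol u))"

definition weyl_lc :: "'k::field_char_0 weyl1 \<Rightarrow> 'k"
  where "weyl_lc u = lead_coeff (lead_coeff (symbol u))"

lemma weyl_lc_eq_0_iff [simp]: "weyl_lc u = 0 \<longleftrightarrow> u = 0"
  by (simp add: weyl_lc_def)

lemma weyl_lc_mult: "weyl_lc (u * v) = weyl_lc u * weyl_lc v"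
  by (cases "u = 0"; cases "v = 0")
    (simp_all add: weyl_lc_def symbol_mult star_nonzero coeff_star lead_coeff_mult)

text \<open>Leading coefficients multiply in the field and vanish only at 0, so \<open>A_1\<close>
  is a domain.\<close>

lemma weyl1_mult_eq_0_iff [simp]: "u * v = 0 \<longleftrightarrow> u = 0 \<or> v = (0 :: 'k::field_char_0 weyl1)"
  using weyl_lc_mult[of u v] by (metis mult_eq_0_iff weyl_lc_eq_0_iff)

lemma q_degree_mult: "u \<noteq> 0 \<Longrightarrow> v \<noteq> 0 \<Longrightarrow> q_degree (u * v) = q_degree u + q_degree v"
  by (simp add: q_degree_def symbol_mult star_nonzero)

lemma p_degree_mult: "u \<noteq> 0 \<Longrightarrow> v \<noteq> 0 \<Longrightarrow> p_degree (u * v) = p_degree u + p_degree v"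
  by (simp add: p_degree_def symbol_mult star_nonzero coeff_star degree_mult_eq)

lemma degrees_scale:
  assumes "c \<noteq> 0"
  shows "q_degree (weyl_scale c u) = q_degree u" "p_degree (weyl_scale c u) = p_degree u"
    "weyl_lc (weyl_scale c u) = c * weyl_lc u"
  using assms by (simp_all add: q_degree_def p_degree_def weyl_lc_def symbol_scale lead_coeff_mult)

text \<open>The leading term of a commutator is governed by the determinant of the two exponent vectors,
  so the exponents of commuting elements are parallel.\<close>

lemma commute_imp_degrees_parallel:
  assumes "u * v = v * (u :: 'k::field_char_0 weyl1)" "u \<noteq> 0" "v \<noteq> 0"
  shows "q_degree u * p_degree v = q_degree v * p_degree u"
proof -
  define F G n m a b where defs: "F = symbol u" "G = symbol v" "n = degree F" "m = degree G"
    "a = lead_coeff F" "b = lead_coeff G"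
  have nz: "a \<noteq> 0" "b \<noteq> 0" using assms by (simp_all add: defs)
  have "star F G = star G F" using assms(1) by (simp add: defs flip: symbol_mult)
  then have "coeff (pCons 0 (star F G)) (n + m) = coeff (pCons 0 (star G F)) (m + n)"
    by (simp add: add.commute)
  \<comment> \<open>The remaining terms of the subleading coefficient are symmetric in
    \<open>F\<close> and \<open>G\<close>, since \<open>K[x]\<close> is commutative, and
    cancel.\<close>
  then have eq: "of_nat n * a * pderiv b = of_nat m * b * pderiv a"
    by (simp add: coeff_star(2) defs)
  \<comment> \<open>This includes constants, where both sides are 0.\<close>
  have lp: "lead_coeff (pderiv c) = of_nat (degree c) * lead_coeff c" for c :: "'k poly"
    by (cases "degree c") (auto simp: degree_pderiv coeff_pderiv pderiv_eq_0_iff coeff_eq_0)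
  have "lead_coeff (of_nat n * a * pderiv b) = of_nat (n * degree b) * (lead_coeff a * lead_coeff b)"
    by (simp only: lead_coeff_mult lp lead_coeff_of_nat) simp
  moreover have "lead_coeff (of_nat m * b * pderiv a) = of_nat (m * degree a) * (lead_coeff a * lead_coeff b)"
    by (simp only: lead_coeff_mult lp lead_coeff_of_nat) simp
  ultimately have "of_nat (n * degree b) = (of_nat (m * degree a) :: 'k)"
    using eq nz by simp
  then have "n * degree b = m * degree a" by (simp only: of_nat_eq_iff)
  then show ?thesis by (simp add: q_degree_def p_degree_def defs)
qed

section \<open>Weights and cancellation of leading monomials\<close>

definition weyl_weight :: "'k::field_char_0 weyl1 \<Rightarrow> nat"
  where "weyl_weight u = q_degree u + p_degree u"

lemma weyl_weight_mult: "u \<noteq> 0 \<Longrightarrow> v \<noteq> 0 \<Longrightarrow> weyl_weight (u * v) = weyl_weight u + weyl_weight v"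
  by (simp add: weyl_weight_def q_degree_mult p_degree_mult)

text \<open>The weight sees only the leading monomial, but \<open>q_degree\<close> zero leaves a
  single coefficient in \<open>K[x]\<close>, whose degree is then zero too.\<close>

lemma weyl_weight_eq_0_imp_scalar:
  assumes "weyl_weight u = 0"
  shows "u \<in> range weyl_scalar"
proof -
  from assms[unfolded weyl_weight_def q_degree_def p_degree_def add_is_0]
  have "degree (symbol u) = 0" "degree (lead_coeff (symbol u)) = 0"
    by blast+
  then obtain c where "symbol u = [:[:c:]:]"
    by (elim degree_eq_zeroE) (auto elim: degree_eq_zeroE)
  then have "u = weyl_scalar c" by (metis symbol_scalar weyl_of_symbol_symbol)
  then show ?thesis by blast
qed

lemma weyl_degrees_power:
  assumes "u \<noteq> (0 :: 'k::field_char_0 weyl1)"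
  shows "u ^ n \<noteq> 0" "weyl_weight (u ^ n) = n * weyl_weight u"
proof -
  have "weyl_weight (1 :: 'k weyl1) = 0"
    using symbol_scalar[of "1::'k"]
    by (simp add: weyl_weight_def q_degree_def p_degree_def weyl_scalar_one)
  moreover have "u ^ n \<noteq> 0 \<and> weyl_weight (u ^ n) = weyl_weight (1 :: 'k weyl1) + n * weyl_weight u"
    using assms by (induction n) (simp_all add: weyl_weight_mult)
  ultimately show "u ^ n \<noteq> 0" "weyl_weight (u ^ n) = n * weyl_weight u" by auto
qed

text \<open>Equal leading terms cancel, so the leading monomial drops lexicographically; when the
  power of \<open>q\<close> drops, that of \<open>p\<close> may grow, hence the disjunction. Since 0
  has degrees 0 by convention, \<open>u = v\<close> must be excluded.\<close>

lemma lex_degrees_diff_less: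
  assumes "q_degree u = q_degree v" "p_degree u = p_degree v" "weyl_lc u = weyl_lc v" "u \<noteq> v"
  shows "q_degree (u - v) < q_degree u
    \<or> q_degree (u - v) = q_degree u \<and> p_degree (u - v) < p_degree u"
proof -
  have s: "symbol (u - v) = symbol u - symbol v"
    using symbol_add[of "u - v" v] by simp
  define n where "n = degree (symbol u)"
  have n: "degree (symbol v) = n" using assms by (simp add: n_def q_degree_def)
  have ne: "symbol u - symbol v \<noteq> 0" using assms(4) by (metis s eq_iff_diff_eq_0 symbol_eq_0_iff)
  have le: "degree (symbol u - symbol v) \<le> n"
    by (rule degree_diff_le) (simp_all add: n n_def)
  show ?thesis
  proof (cases "degree (symbol u - symbol v) = n")
    case False
    then show ?thesis using le by (simp add: q_degree_def s n_def)
  next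
    case True
    define a b where "a = coeff (symbol u) n" "b = coeff (symbol v) n"
    have ab: "degree a = degree b" "lead_coeff a = lead_coeff b"
      using assms by (simp_all add: p_degree_def weyl_lc_def a_b_def n flip: n_def)
    have "a - b \<noteq> 0" using ne True by (metis a_b_def coeff_diff leading_coeff_0_iff)
    moreover have "degree (a - b) \<le> degree a" using degree_diff_le[of a "degree a" b] ab by simp
    moreover have "coeff (a - b) (degree a) = 0" using ab by simp
    ultimately have "degree (a - b) < degree a"
      by (metis leading_coeff_0_iff order_le_less)
    then show ?thesis
      using True by (simp add: q_degree_def p_degree_def s a_b_def flip: n_def)
  qed
qed

lemma weyl_degrees_add:
  assumes "q_degree u = q_degree v" "p_degree u = p_degree v" "weyl_lc u + weyl_lc v \<noteq> 0"
    shows "q_degree (u + v) = q_degree u" "p_degree (u + v) = p_degree u"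
    "weyl_lc (u + v) = weyl_lc u + weyl_lc v"
proof -
  define n where "n = degree (symbol u)"
  have n: "degree (symbol v) = n" using assms by (simp add: n_def q_degree_def)
  define a b where "a = coeff (symbol u) n" "b = coeff (symbol v) n"
  have ab: "degree a = degree b"
    using assms by (simp_all add: p_degree_def a_b_def n flip: n_def)
  have nz: "coeff (a + b) (degree a) \<noteq> 0"
    using assms(3) ab by (simp add: weyl_lc_def a_b_def n flip: n_def)
  have d: "degree (a + b) = degree a"
    using nz le_degree[OF nz] degree_add_le[of a "degree a" b] ab by simp
  have "coeff (symbol u + symbol v) n \<noteq> 0" using nz by (metis a_b_def coeff_add coeff_0)
  then have d': "degree (symbol u + symbol v) = n"
    using le_degree[of "symbol u + symbol v" n] degree_add_le[of "symbol u" n "symbol v"]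
    by (simp add: n n_def)
  show "q_degree (u + v) = q_degree u"
    using d' by (simp add: q_degree_def symbol_add n_def)
  show "p_degree (u + v) = p_degree u"
    using d' d by (simp add: p_degree_def symbol_add a_b_def flip: n_def)
  show "weyl_lc (u + v) = weyl_lc u + weyl_lc v"
    using d' d ab by (simp add: weyl_lc_def symbol_add a_b_def n flip: n_def)
qed

text \<open>The Leibniz rule for \<open>x ^ n * x\<close>, leaving a commutator with a lower power
  for induction.\<close>

lemma commutator_power:
  "x ^ Suc n * y - y * x ^ Suc n = x ^ n * (x * y - y * x) + (x ^ n * y - y * x ^ n) * (x :: 'a::ring_1)"
proof -
  have "x ^ n * (x * y) = x * (x ^ n * y)" by (simp add: power_commutes flip: mult.assoc)
  then show ?thesis by (simp add: algebra_simps power_commutes)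
qed

text \<open>The iterated commutator sum has \<open>n\<close> terms with the same leading term, which cannot cancel in
  characteristic zero.\<close>

lemma commutator_power_degrees:
  fixes D E :: "'k::field_char_0 weyl1"
  assumes "D * E \<noteq> E * D"
  defines "Z \<equiv> D * E - E * D"
  shows "q_degree (D ^ Suc n * E - E * D ^ Suc n) = q_degree (D ^ n * Z) \<and>
    p_degree (D ^ Suc n * E - E * D ^ Suc n) = p_degree (D ^ n * Z) \<and>
    weyl_lc (D ^ Suc n * E - E * D ^ Suc n) = of_nat (Suc n) * weyl_lc (D ^ n * Z)"
proof (induction n)
  case 0
  show ?case by (simp add: Z_def)
next
  case (Suc n)
  define U where "U = D ^ Suc n * E - E * D ^ Suc n"
  have D: "D \<noteq> 0" and Z: "Z \<noteq> 0" using assms by auto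
  have Dn: "D ^ n \<noteq> 0" using D by (rule weyl_degrees_power)
  note IH = Suc.IH[folded U_def]
  have "weyl_lc U \<noteq> 0" using IH Dn Z by (simp del: of_nat_Suc)
  then have U: "U \<noteq> 0" by simp
  have q: "q_degree (D ^ Suc n * Z) = q_degree (U * D)"
    and p: "p_degree (D ^ Suc n * Z) = p_degree (U * D)"
    using U D Z Dn IH by (simp_all add: q_degree_mult p_degree_mult)
  \<comment> \<open>The two summands of the Leibniz rule differ in the order of factors, which
    leading terms do not see; their coefficients stand in the ratio \<open>1\<close> to
    \<open>Suc n\<close>.\<close>
  have l: "weyl_lc (U * D) = of_nat (Suc n) * weyl_lc (D ^ Suc n * Z)"
    using IH by (simp add: weyl_lc_mult)
  have l': "weyl_lc (D ^ Suc n * Z) + weyl_lc (U * D) = of_nat (Suc (Suc n)) * weyl_lc (D ^ Suc n * Z)"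
    unfolding l by (simp add: algebra_simps)
  moreover have "\<dots> \<noteq> 0" using D Z Dn by (simp del: of_nat_Suc)
  ultimately have "weyl_lc (D ^ Suc n * Z) + weyl_lc (U * D) \<noteq> 0" by metis
  from weyl_degrees_add[OF q p this] show ?case
    unfolding commutator_power[of D "Suc n"] Z_def[symmetric] U_def[symmetric] l' by blast
qed

text \<open>All exponent vectors of elements of the centralizer lie on one ray, so they are determined by
  their weight, and elements of equal weight have proportional leading terms.  Take a noncommuting
  pair \<open>D, E\<close> in the centralizer for which the weight of the commutator drops least.  Then some
  \<open>D\<^sup>n - c z\<^sup>d\<close> has smaller weight than \<open>D\<^sup>n\<close> and the same commutator with \<open>E\<close>, although
  \<open>[D\<^sup>n, E]\<close> drops exactly as much as \<open>[D, E]\<close>; this contradicts minimality.\<close>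

theorem weyl_centralizer_commutative:
  fixes z :: "'k::field_char_0 weyl1"
  assumes "z \<notin> range weyl_scalar" "x * z = z * x" "y * z = z * y"
  shows "x * y = y * x"
proof (rule ccontr)
  assume "x * y \<noteq> y * x"
  define C where "C = {u. u * z = z * u}"
  have Cdiff: "u - v \<in> C" if "u \<in> C" "v \<in> C" for u v
    using that by (simp add: C_def algebra_simps)
  have Cmult: "u * v \<in> C" if "u \<in> C" "v \<in> C" for u v
    using that unfolding C_def by (metis (mono_tags, lifting) mem_Collect_eq mult.assoc)
  have Cscale: "weyl_scale c u \<in> C" if "u \<in> C" for c u
    using that by (simp add: C_def weyl_scale_mult_left weyl_scale_mult_right)
  have Cpower: "u ^ n \<in> C" if "u \<in> C" for u n
    using that by (simp add: C_def power_commuting_commutes)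
  have z0: "z \<noteq> 0" using assms(1) weyl_scalar_zero by (metis rangeI)
  have wz: "weyl_weight z > 0" using assms(1) weyl_weight_eq_0_imp_scalar by blast
  define i j where "i = q_degree z" "j = p_degree z"
  have par: "q_degree u * j = i * p_degree u" if "u \<in> C" "u \<noteq> 0" for u
    using commute_imp_degrees_parallel[of u z] that z0 by (simp add: C_def i_j_def)
  have wt: "i * weyl_weight u = weyl_weight z * q_degree u" "j * weyl_weight u = weyl_weight z * p_degree u"
    if "u \<in> C" "u \<noteq> 0" for u
    using par[OF that] by (simp_all add: weyl_weight_def flip: i_j_def) (simp_all add: algebra_simps)
  have lower: "weyl_weight (u - v) < weyl_weight u"
    if "u \<in> C" "v \<in> C" "u \<noteq> 0" "v \<noteq> 0" "weyl_weight u = weyl_weight v" "weyl_lc u = weyl_lc v" "u \<noteq> v" for u v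
  proof -
    have "q_degree u = q_degree v" "p_degree u = p_degree v"
      using wt[of u] wt[of v] that wz by auto
    \<comment> \<open>On the common ray a drop in either exponent forces a drop in weight, so the
      possible growth of the other exponent is excluded.\<close>
    from lex_degrees_diff_less[OF this that(6,7)]
    have "weyl_weight z * q_degree (u - v) < weyl_weight z * q_degree u
      \<or> weyl_weight z * p_degree (u - v) < weyl_weight z * p_degree u"
      using wz by auto
    then show ?thesis
      using wt[of u] wt[of "u - v"] that Cdiff by (metis eq_iff_diff_eq_0 nat_mult_less_cancel_disj)
  qed
  define drop where "drop u v = weyl_weight u + weyl_weight v - weyl_weight (u * v - v * u)"
    for u v :: "'k weyl1"
  define Q where "Q = (\<lambda>(u, v). u \<in> C \<and> v \<in> C \<and> u * v \<noteq> v * u)"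
  have "Q (x, y)" using assms \<open>x * y \<noteq> y * x\<close> by (simp add: Q_def C_def)
  then obtain D E where DE: "Q (D, E)" and least: "\<And>u v. Q (u, v) \<Longrightarrow> drop D E \<le> drop u v"
    using ex_has_least_nat[of Q "(x, y)" "\<lambda>(u, v). drop u v"] by auto
  define Z where "Z = D * E - E * D"
  have nz: "D \<noteq> 0" "E \<noteq> 0" "Z \<noteq> 0" and inC: "D \<in> C" "E \<in> C" using DE by (auto simp: Q_def Z_def)
  \<comment> \<open>The exponents are crossed so that \<open>D ^ n\<close> and \<open>z ^ d\<close>
    have the same weight \<open>n * d\<close>; \<open>c\<close> then matches their leading
    coefficients.\<close>
  define d n where "d = weyl_weight D" "n = weyl_weight z"
  define c where "c = weyl_lc (D ^ n) / weyl_lc (z ^ d)"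
  define R where "R = D ^ n - weyl_scale c (z ^ d)"
  have p0: "D ^ n \<noteq> 0" "z ^ d \<noteq> 0" using nz z0 weyl_degrees_power by blast+
  have c0: "c \<noteq> 0" using p0 by (simp add: c_def)
  have zC: "z \<in> C" by (simp add: C_def)
  have comm: "R * E - E * R = D ^ n * E - E * D ^ n"
  proof -
    have "z ^ d * E = E * z ^ d" using inC(2) by (simp add: C_def power_commuting_commutes)
    then have "weyl_scale c (z ^ d) * E = E * weyl_scale c (z ^ d)"
      by (simp add: weyl_scale_mult_left weyl_scale_mult_right)
    then show ?thesis by (simp add: R_def algebra_simps)
  qed
  obtain k where k: "n = Suc k" using wz by (metis d_n_def(2) gr0_implies_Suc)
  have lead: "weyl_weight (D ^ n * E - E * D ^ n) = k * d + weyl_weight Z"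
    "weyl_lc (D ^ n * E - E * D ^ n) \<noteq> 0"
    using commutator_power_degrees[of D E k, folded Z_def] nz weyl_degrees_power[of D k]
      weyl_weight_mult[of "D ^ k" Z]
    by (auto simp: k weyl_weight_def d_n_def Z_def weyl_lc_mult simp del: of_nat_Suc)
  then have RE: "R * E \<noteq> E * R" by (simp flip: comm)
  then have R0: "D ^ n \<noteq> weyl_scale c (z ^ d)" by (auto simp: R_def)
  have RC: "R \<in> C" unfolding R_def using inC zC by (intro Cdiff Cscale Cpower)
  have "weyl_weight R < weyl_weight (D ^ n)"
    unfolding R_def
  proof (rule lower)
    show "D ^ n \<in> C" "weyl_scale c (z ^ d) \<in> C" using inC zC Cscale Cpower by blast+
    show "D ^ n \<noteq> 0" "weyl_scale c (z ^ d) \<noteq> 0" using p0 c0 by simp_all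
    have "weyl_weight (weyl_scale c (z ^ d)) = weyl_weight (z ^ d)"
      using c0 by (simp add: weyl_weight_def degrees_scale)
    then show "weyl_weight (D ^ n) = weyl_weight (weyl_scale c (z ^ d))"
      using weyl_degrees_power[OF nz(1)] weyl_degrees_power[OF z0] by (simp add: d_n_def)
    show "weyl_lc (D ^ n) = weyl_lc (weyl_scale c (z ^ d))"
      using c0 p0 by (simp add: degrees_scale) (simp add: c_def)
  qed (rule R0)
  then have wR: "weyl_weight R < n * d"
    using weyl_degrees_power[OF nz(1)] by (simp add: d_n_def)
  \<comment> \<open>This makes \<open>drop D E\<close> positive, so the final comparison stays
    strict even if the subtraction in \<open>drop R E\<close> truncates to 0.\<close>
  have small: "weyl_weight Z < d + weyl_weight E"
  proof -
    have "weyl_weight (D * E) = weyl_weight (E * D)" "weyl_lc (D * E) = weyl_lc (E * D)"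
      using nz by (simp_all add: weyl_weight_mult weyl_lc_mult)
    then have "weyl_weight Z < weyl_weight (D * E)"
      unfolding Z_def using nz inC Cmult DE by (intro lower) (auto simp: Q_def)
    then show ?thesis using nz by (simp add: weyl_weight_mult d_n_def)
  qed
  have "drop D E \<le> drop R E" using least RE RC inC by (simp add: Q_def)
  then show False
    using wR small by (simp add: drop_def comm lead flip: Z_def d_n_def) (simp add: k)
qed

section \<open>Locally finite, nilpotent and diagonalizable adjoint actions\<close>

lemma ad_add: "ad z (x + y) = ad z x + ad z y"
  by (simp add: ad_def algebra_simps)

lemma ad_0 [simp]: "ad z 0 = 0"
  by (simp add: ad_def)

lemma ad_sum: "ad z (\<Sum>i\<in>I. f i) = (\<Sum>i\<in>I. ad z (f i))"
  by (induction I rule: infinite_finite_induct) (simp_all add: ad_add)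

lemma ad_scale: "ad z (weyl_scale c x) = weyl_scale c (ad z x)"
  by (simp add: ad_def weyl_scale_mult_left weyl_scale_mult_right weyl1.scale_right_diff_distrib)

lemma ad_funpow_sum: "(ad z ^^ m) (\<Sum>i\<in>I. f i) = (\<Sum>i\<in>I. (ad z ^^ m) (f i))"
  by (induction m) (simp_all add: ad_sum)

definition ad_poly :: "'k::field weyl1 \<Rightarrow> 'k poly \<Rightarrow> 'k weyl1 \<Rightarrow> 'k weyl1"
  where "ad_poly z f x = (\<Sum>i\<le>degree f. weyl_scale (coeff f i) ((ad z ^^ i) x))"

lemma ad_orbit_eq: "ad_orbit weyl_scale z x = range (\<lambda>f. ad_poly z f x)"
  by (auto simp: ad_orbit_def ad_poly_def)

lemma ad_poly_bound:
  assumes "degree f \<le> n"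
  shows "ad_poly z f x = (\<Sum>i\<le>n. weyl_scale (coeff f i) ((ad z ^^ i) x))"
  unfolding ad_poly_def using assms
  by (intro sum.mono_neutral_left) (auto simp: coeff_eq_0)

lemma ad_poly_monom: "ad_poly z (monom c n) x = weyl_scale c ((ad z ^^ n) x)"
proof -
  have "ad_poly z (monom c n) x = (\<Sum>i\<le>n. if i = n then weyl_scale c ((ad z ^^ n) x) else 0)"
    unfolding ad_poly_bound[OF degree_monom_le] by (intro sum.cong) auto
  then show ?thesis by simp
qed

lemma ad_ad_poly: "ad z (ad_poly z f x) = ad_poly z f (ad z x)"
  by (simp add: ad_poly_def ad_sum ad_scale flip: funpow_Suc_right funpow_swap1)

text \<open>Peels one root off a polynomial in \<open>ad z\<close>, the step that drives the
  induction on annihilators.\<close>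

lemma ad_poly_mult_linear:
  "ad_poly z ([:- l, 1:] * g) x = ad_poly z g (ad z x) - weyl_scale l (ad_poly z g x)"
proof -
  define n where "n = degree g"
  have c: "coeff ([:- l, 1:] * g) i = coeff (pCons 0 g) i - l * coeff g i" for i
    by simp
  have d: "degree ([:- l, 1:] * g) \<le> Suc n"
    using degree_mult_le[of "[:- l, 1:]" g] by (simp add: n_def)
  have "ad_poly z ([:- l, 1:] * g) x
      = (\<Sum>i\<le>Suc n. weyl_scale (coeff (pCons 0 g) i) ((ad z ^^ i) x))
        - (\<Sum>i\<le>Suc n. weyl_scale (l * coeff g i) ((ad z ^^ i) x))"
    unfolding ad_poly_bound[OF d] c weyl1.scale_left_diff_distrib sum_subtractf ..
  also have "(\<Sum>i\<le>Suc n. weyl_scale (coeff (pCons 0 g) i) ((ad z ^^ i) x)) = ad_poly z g (ad z x)"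
    by (subst sum.atMost_Suc_shift) (simp add: ad_poly_def n_def funpow_swap1)
  also have "(\<Sum>i\<le>Suc n. weyl_scale (l * coeff g i) ((ad z ^^ i) x)) = weyl_scale l (ad_poly z g x)"
    unfolding ad_poly_bound[of g "Suc n" z x, unfolded n_def, OF le_SucI[OF order_refl]] n_def
    by (simp add: weyl1.scale_sum_right weyl1.scale_right_distrib)
  finally show ?thesis .
qed

text \<open>The first \<open>card B + 1\<close> iterates lie in the span of \<open>card B\<close>
  vectors, so they satisfy a linear relation, whose coefficients form \<open>f\<close>.\<close>

lemma ad_F_annihilator:
  assumes "x \<in> ad_F weyl_scale z"
  obtains f where "f \<noteq> 0" "ad_poly z f x = 0"
proof -
  from assms obtain B where B: "finite B" "ad_orbit weyl_scale z x \<subseteq> weyl1.span B"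
    by (auto simp: ad_F_def)
  define n where "n = card B"
  define v where "v i = (ad z ^^ i) x" for i
  have v: "v i \<in> weyl1.span B" for i
    using B(2) ad_poly_monom[of z 1 i x] by (auto simp: ad_orbit_eq v_def image_subset_iff) metis
  show ?thesis
  \<comment> \<open>Independence concerns sets of vectors, in which repeated iterates collapse; a
    repetition gives the relation directly.\<close>
  proof (cases "inj_on v {..n}")
    case False
    then obtain i j where ij: "i \<noteq> j" "v i = v j" by (auto simp: inj_on_def)
    define f where "f = (monom 1 i - monom 1 j :: 'a poly)"
    have "coeff f i = 1" using ij by (simp add: f_def)
    then have "f \<noteq> 0" by auto
    have d: "degree f \<le> max i j" "degree (monom (1::'a) i) \<le> max i j" "degree (monom (1::'a) j) \<le> max i j"
      unfolding f_def by (auto intro!: degree_diff_le simp: degree_monom_eq)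
    have "ad_poly z f x = ad_poly z (monom 1 i) x - ad_poly z (monom 1 j) x"
      unfolding d[THEN ad_poly_bound] sum_subtractf[symmetric]
      by (simp add: f_def weyl1.scale_left_diff_distrib)
    also have "\<dots> = 0" using ij(2) by (simp add: ad_poly_monom v_def)
    finally show ?thesis using \<open>f \<noteq> 0\<close> that by blast
  next
    case True
    have "weyl1.dependent (v ` {..n})"
    proof (rule ccontr)
      assume "\<not> weyl1.dependent (v ` {..n})"
      moreover have "v ` {..n} \<subseteq> weyl1.span B" using v by auto
      ultimately have "card (v ` {..n}) \<le> card B"
        using weyl1.independent_span_bound[OF B(1)] by blast
      then show False using True by (simp add: card_image n_def)
    qed
    then obtain u where u: "\<exists>w\<in>v ` {..n}. u w \<noteq> 0" "(\<Sum>w\<in>v ` {..n}. weyl_scale (u w) w) = 0"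
      by (subst (asm) weyl1.dependent_finite) auto
    define f where "f = (\<Sum>i\<le>n. monom (u (v i)) i)"
    have c: "coeff f i = (if i \<le> n then u (v i) else 0)" for i
      unfolding f_def by (simp add: coeff_sum)
    have "f \<noteq> 0" using u(1) c by (metis (no_types, lifting) atMost_iff coeff_0 imageE)
    have "degree f \<le> n" using c by (intro degree_le) auto
    then have "ad_poly z f x = (\<Sum>i\<le>n. weyl_scale (u (v i)) (v i))"
      unfolding ad_poly_bound[OF \<open>degree f \<le> n\<close>] by (simp add: c v_def)
    also have "\<dots> = 0" using u(2) by (simp add: sum.reindex[OF True])
    finally show ?thesis using \<open>f \<noteq> 0\<close> that by blast
  qed
qed

text \<open>An annihilating polynomial splits into linear factors. Those with nonzero root act
  injectively, as 0 is the only eigenvalue, and can be cancelled; a power of \<open>ad z\<close>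
  remains.\<close>

lemma ad_F_subset_ad_N:
  fixes z :: "'k::{alg_closed_field, field_char_0} weyl1"
  assumes "ad_Ev weyl_scale z = {0}"
  shows "ad_F weyl_scale z \<subseteq> ad_N z"
proof
  fix x assume "x \<in> ad_F weyl_scale z"
  then obtain f where "f \<noteq> 0" "ad_poly z f x = 0" by (rule ad_F_annihilator)
  \<comment> \<open>The vector is generalized as well: splitting off the root 0 replaces
    \<open>x\<close> by \<open>ad z x\<close>.\<close>
  then show "x \<in> ad_N z"
  proof (induction "degree f" arbitrary: f x)
    case 0
    then obtain c where "f = [:c:]" by (metis degree_0_id)
    with 0 have "x = 0" by (simp add: ad_poly_def)
    then show ?case by (auto simp: ad_N_def intro: exI[of _ 0])
  next
    case (Suc n)
    then obtain l where "poly f l = 0" using alg_closed_imp_poly_has_root[of f] by auto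
    then obtain g where f: "f = [:- l, 1:] * g" by (auto simp: poly_eq_0_iff_dvd)
    have g: "g \<noteq> 0" using Suc.prems f by auto
    have "degree f = Suc (degree g)"
      unfolding f using g by (subst degree_mult_eq) auto
    then have n: "n = degree g" using Suc.hyps(2) by simp
    have eq: "ad_poly z g (ad z x) = weyl_scale l (ad_poly z g x)"
      using Suc.prems(2) by (simp add: f ad_poly_mult_linear del: mult_pCons_left)
    show ?case
    proof (cases "l = 0")
      case False
      then have "l \<notin> ad_Ev weyl_scale z" using assms by auto
      then have "ad_poly z g x = 0" using eq by (auto simp: ad_Ev_def ad_ad_poly)
      then show ?thesis using Suc.hyps(1) g n by blast
    next
      case True
      then have "ad z x \<in> ad_N z" using Suc.hyps(1) g n eq by auto
      then obtain m where "(ad z ^^ m) (ad z x) = 0" by (auto simp: ad_N_def)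
      then have "(ad z ^^ Suc m) x = 0" by (simp add: funpow_swap1)
      then show ?thesis unfolding ad_N_def by blast
    qed
  qed
qed

text \<open>Applying \<open>ad z - m\<close> kills the component at \<open>m\<close> and rescales
  the others by nonzero factors \<open>l - m\<close>.\<close>

lemma ad_eigenvectors_independent:
  assumes "finite L" "\<And>l. l \<in> L \<Longrightarrow> ad z (v l) = weyl_scale l (v l)" "(\<Sum>l\<in>L. v l) = 0" "l \<in> L"
  shows "v l = 0"
  using assms
proof (induction L arbitrary: v l rule: finite_induct)
  case (insert m L)
  have sum: "v m + (\<Sum>l\<in>L. v l) = 0" using insert.hyps insert.prems(2) by simp
  have "(\<Sum>l\<in>L. weyl_scale (l - m) (v l)) = (\<Sum>l\<in>L. ad z (v l)) - weyl_scale m (\<Sum>l\<in>L. v l)"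
    using insert.prems(1)
    by (simp add: weyl1.scale_left_diff_distrib weyl1.scale_sum_right sum_subtractf)
  also have "\<dots> = ad z (v m + (\<Sum>l\<in>L. v l)) - weyl_scale m (v m + (\<Sum>l\<in>L. v l))"
    using insert.prems(1) by (simp add: ad_add ad_sum weyl1.scale_right_distrib)
  also have "\<dots> = 0" by (simp add: sum)
  finally have sum0: "(\<Sum>l\<in>L. weyl_scale (l - m) (v l)) = 0" .
  have "weyl_scale (l - m) (v l) = 0" if "l \<in> L" for l
  proof (rule insert.IH[OF _ sum0 that])
    fix k assume "k \<in> L"
    then have "ad z (v k) = weyl_scale k (v k)" using insert.prems(1) by blast
    then show "ad z (weyl_scale (k - m) (v k)) = weyl_scale k (weyl_scale (k - m) (v k))"
      by (simp add: ad_scale mult.commute)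
  qed
  then have L: "v l = 0" if "l \<in> L" for l using that insert.hyps(2) by auto
  then have "v m = 0" using sum by simp
  then show ?case using L insert.prems(3) by auto
qed simp

lemma ad_D_decomposition:
  assumes "y \<in> ad_D weyl_scale z"
  obtains L v where "finite L" "\<And>l. l \<in> L \<Longrightarrow> ad z (v l) = weyl_scale l (v l)" "y = (\<Sum>l\<in>L. v l)"
proof -
  have "\<exists>L v. finite L \<and> (\<forall>l\<in>L. ad z (v l) = weyl_scale l (v l)) \<and> y = (\<Sum>l\<in>L. v l)"
    using assms unfolding ad_D_def
  proof (induction rule: weyl1.span_induct_alt)
    case base
    show ?case by (intro exI[of _ "{}"]) simp
  next
    case (step c x y)
    then obtain m where x: "ad z x = weyl_scale m x" by (auto simp: ad_eigenspace_def)
    from step obtain L v where L: "finite L" "\<forall>l\<in>L. ad z (v l) = weyl_scale l (v l)" "y = (\<Sum>l\<in>L. v l)"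
      by blast
    \<comment> \<open>The new eigenvector is merged into the component at \<open>m\<close>, which
      starts from 0 if \<open>m\<close> is not in \<open>L\<close>.\<close>
    define v' where "v' = (\<lambda>l. (if l \<in> L then v l else 0) + (if l = m then weyl_scale c x else 0))"
    have "(\<Sum>l\<in>insert m L. v' l) = (\<Sum>l\<in>insert m L. if l \<in> L then v l else 0) + weyl_scale c x"
      using L(1) by (simp add: v'_def sum.distrib del: sum.insert)
    also have "(\<Sum>l\<in>insert m L. if l \<in> L then v l else 0) = y"
      unfolding L(3) using L(1) by (intro sum.mono_neutral_cong_right) auto
    finally have "weyl_scale c x + y = (\<Sum>l\<in>insert m L. v' l)" by (simp add: add.commute)
    moreover have "\<forall>l\<in>insert m L. ad z (v' l) = weyl_scale l (v' l)"
      using L(2) x by (auto simp: v'_def ad_add ad_scale weyl1.scale_right_distrib mult.commute)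
    ultimately show ?case using L(1) by blast
  qed
  then show ?thesis using that by blast
qed

text \<open>The \<open>m\<close>-th iterate scales the component at \<open>l\<close> by
  \<open>l ^ m\<close>; independence leaves only the eigenvalue 0.\<close>

lemma ad_D_inter_ad_N_subset_ad_C: "ad_D weyl_scale z \<inter> ad_N z \<subseteq> ad_C z"
proof
  fix y assume "y \<in> ad_D weyl_scale z \<inter> ad_N z"
  then obtain m L v where m: "(ad z ^^ m) y = 0" and L: "finite L"
    "\<And>l. l \<in> L \<Longrightarrow> ad z (v l) = weyl_scale l (v l)" "y = (\<Sum>l\<in>L. v l)"
    by (auto simp: ad_N_def elim: ad_D_decomposition)
  have "(ad z ^^ k) (v l) = weyl_scale (l ^ k) (v l)" if "l \<in> L" for k l
    by (induction k) (simp_all add: ad_scale L(2)[OF that])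
  then have "(\<Sum>l\<in>L. weyl_scale (l ^ m) (v l)) = 0"
    using m by (simp add: L(3) ad_funpow_sum)
  then have "weyl_scale (l ^ m) (v l) = 0" if "l \<in> L" for l
    using ad_eigenvectors_independent[of L z "\<lambda>l. weyl_scale (l ^ m) (v l)" l, OF L(1) _ _ that]
    by (simp add: ad_scale L(2) mult.commute)
  then have "l = 0 \<or> v l = 0" if "l \<in> L" for l using that by fastforce
  then have "ad z (v l) = 0" if "l \<in> L" for l using that L(2) by fastforce
  then show "y \<in> ad_C z" by (simp add: ad_C_def L(3) ad_sum)
qed

text \<open>The span of \<open>B\<close> is stable under \<open>ad z\<close>, hence contains every
  orbit starting in \<open>B\<close>.\<close>

lemma subset_ad_F:
  assumes "finite B" "\<And>b. b \<in> B \<Longrightarrow> ad z b \<in> weyl1.span B"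
  shows "B \<subseteq> ad_F weyl_scale z"
proof
  fix x assume "x \<in> B"
  have "ad z y \<in> weyl1.span B" if "y \<in> weyl1.span B" for y
    using that
    by (induction rule: weyl1.span_induct_alt)
      (auto simp: ad_add ad_scale intro: assms weyl1.span_add weyl1.span_scale weyl1.span_zero)
  then have "(ad z ^^ i) x \<in> weyl1.span B" for i
    using \<open>x \<in> B\<close> by (induction i) (auto intro: weyl1.span_base)
  then have "ad_orbit weyl_scale z x \<subseteq> weyl1.span B"
    by (auto simp: ad_orbit_def intro!: weyl1.span_sum weyl1.span_scale)
  then show "x \<in> ad_F weyl_scale z" using assms(1) by (auto simp: ad_F_def)
qed

section \<open>Reduced representations of tensors\<close>

text \<open>Zero and scalar multiples need no cases of their own: 0 is \<open>0 \<otimes> 0\<close>,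
  and scalars are absorbed into the left factor.\<close>

lemma weyl2_induct [case_names tensor add]:
  assumes tensor: "\<And>a b. Q (a \<otimes> b)" and add: "\<And>u v. Q u \<Longrightarrow> Q v \<Longrightarrow> Q (u + v)"
  shows "Q w"
proof -
  have "Q (abs_weyl2 u)" for u
  proof (induction u rule: poly_mapping_additive_induct)
    case zero
    have "abs_weyl2 0 = 0 \<otimes> 0"
      using tensor_null.add_left[of 0 0 0 1] tensor_null_uminus
      by (auto simp: tensor.abs_eq weyl2.abs_eq_iff tensor_cong_def)
    then show ?case using tensor by metis
  next
    case (single k c)
    obtain a b where k: "k = Pair1 a b" by (cases k)
    have "abs_weyl2 (Poly_Mapping.single k c) = weyl_scale c a \<otimes> b"
      using tensor_null_uminus[OF tensor_null.scale_left[of c a b 1]]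
      by (simp add: tensor.abs_eq weyl2.abs_eq_iff tensor_cong_def k)
    then show ?case using tensor by metis
  next
    case (add g h)
    then show ?case using assms(2) by (metis plus_weyl2.abs_eq)
  qed
  then show ?thesis by (metis Quotient3_abs_rep Quotient3_weyl2)
qed

lemma tensor_zero_left [simp]: "0 \<otimes> b = 0"
  using tensor_add_left[of 0 0 b] by simp

lemma tensor_zero_right [simp]: "a \<otimes> 0 = 0"
  using tensor_add_right[of a 0 0] by simp

lemma tensor_sum_left: "(\<Sum>i\<in>I. f i) \<otimes> b = (\<Sum>i\<in>I. f i \<otimes> b)"
  by (induction I rule: infinite_finite_induct) (simp_all add: tensor_add_left)

lemma tensor_sum_right: "a \<otimes> (\<Sum>i\<in>I. f i) = (\<Sum>i\<in>I. a \<otimes> f i)"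
  by (induction I rule: infinite_finite_induct) (simp_all add: tensor_add_right)

lemma tensor_diff_left: "(a - a') \<otimes> b = a \<otimes> b - a' \<otimes> b"
  using tensor_add_left[of "a - a'" a' b] by simp

lemma tensor_diff_right: "a \<otimes> (b - b') = a \<otimes> b - a \<otimes> b'"
  using tensor_add_right[of a "b - b'" b'] by simp

text \<open>The universal property of the tensor product: the linear extension of
  \<open>\<beta>\<close> kills every bilinearity relator. Additivity of \<open>f\<close> suffices
  for evaluating finite sums of pure tensors.\<close>

lemma tensor_lift:
  fixes \<beta> :: "'k::field weyl1 \<Rightarrow> 'k weyl1 \<Rightarrow> 'k weyl1"
  assumes "\<And>a a' b. \<beta> (a + a') b = \<beta> a b + \<beta> a' b" "\<And>a b b'. \<beta> a (b + b') = \<beta> a b + \<beta> a b'"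
    and "\<And>c a b. \<beta> (weyl_scale c a) b = weyl_scale c (\<beta> a b)"
    and "\<And>c a b. \<beta> a (weyl_scale c b) = weyl_scale c (\<beta> a b)"
  obtains f where "\<And>u v. f (u + v) = f u + f v" "\<And>a b. f (a \<otimes> b) = \<beta> a b"
proof -
  define L where "L = linear_extension weyl_scale (\<lambda>k. case k of Pair1 a b \<Rightarrow> \<beta> a b)"
  note L_simps =
    weyl1.linear_extension_single[where \<phi> = "\<lambda>k. case k of Pair1 a b \<Rightarrow> \<beta> a b", folded L_def]
    weyl1.linear_extension_zero[where \<phi> = "\<lambda>k. case k of Pair1 a b \<Rightarrow> \<beta> a b", folded L_def]
    weyl1.linear_extension_add[where \<phi> = "\<lambda>k. case k of Pair1 a b \<Rightarrow> \<beta> a b", folded L_def]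
    weyl1.linear_extension_diff[where \<phi> = "\<lambda>k. case k of Pair1 a b \<Rightarrow> \<beta> a b", folded L_def]
  have "L x = 0" if "x \<in> tensor_null" for x
    using that
    by (induction rule: tensor_null.induct)
      (simp_all add: L_simps assms weyl1.scale_right_distrib)
  then have abs: "L (rep_weyl2 (abs_weyl2 x)) = L x" for x
    using L_simps(4)
    by (metis Quotient3_rep_abs Quotient3_weyl2 eq_iff_diff_eq_0 tensor_cong_def
        equivp_reflp tensor_cong_equivp)
  have "L (rep_weyl2 (u + v)) = L (rep_weyl2 u) + L (rep_weyl2 v)" for u v
  proof -
    have *: "abs_weyl2 (rep_weyl2 t) = t" for t :: "'k weyl2"
      by (rule Quotient3_abs_rep[OF Quotient3_weyl2])
    have "u + v = abs_weyl2 (rep_weyl2 u + rep_weyl2 v)"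
      by (simp add: * flip: plus_weyl2.abs_eq)
    then show ?thesis by (simp only: abs L_simps(3))
  qed
  moreover have "L (rep_weyl2 (a \<otimes> b)) = \<beta> a b" for a b
    by (simp add: tensor.abs_eq abs L_simps)
  ultimately show ?thesis by (rule that)
qed

section \<open>Contraction with linear forms and coordinates of tensors\<close>

definition linear_form :: "('k::field weyl1 \<Rightarrow> 'k) \<Rightarrow> bool"
  where "linear_form \<phi> \<longleftrightarrow>
    (\<forall>a b. \<phi> (a + b) = \<phi> a + \<phi> b) \<and> (\<forall>c a. \<phi> (weyl_scale c a) = c * \<phi> a)"

lemma tensor_contract_left:
  assumes "linear_form \<phi>"
  obtains f where "additive f" "\<And>a b. f (a \<otimes> b) = weyl_scale (\<phi> a) b"
proof (rule tensor_lift[of "\<lambda>a b. weyl_scale (\<phi> a) b"])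
  fix f :: "'a weyl2 \<Rightarrow> 'a weyl1"
  assume "\<And>u v. f (u + v) = f u + f v" "\<And>a b. f (a \<otimes> b) = weyl_scale (\<phi> a) b"
  then show thesis by (intro that[of f]) (simp_all add: additive_def)
qed (use assms in \<open>simp_all add: linear_form_def weyl1.scale_left_distrib weyl1.scale_right_distrib mult.commute\<close>)

lemma tensor_contract_right:
  assumes "linear_form \<psi>"
  obtains f where "additive f" "\<And>a b. f (a \<otimes> b) = weyl_scale (\<psi> b) a"
proof (rule tensor_lift[of "\<lambda>a b. weyl_scale (\<psi> b) a"])
  fix f :: "'a weyl2 \<Rightarrow> 'a weyl1"
  assume "\<And>u v. f (u + v) = f u + f v" "\<And>a b. f (a \<otimes> b) = weyl_scale (\<psi> b) a"
  then show thesis by (intro that[of f]) (simp_all add: additive_def)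
qed (use assms in \<open>simp_all add: linear_form_def weyl1.scale_left_distrib weyl1.scale_right_distrib mult.commute\<close>)

lemma linear_form_representation:
  assumes "weyl1.independent B" "weyl1.span B = UNIV"
  shows "linear_form (\<lambda>a. weyl1.representation B a b)"
  using assms by (simp add: linear_form_def weyl1.representation_add weyl1.representation_scale)

lemma linear_form_sum:
  "linear_form \<phi> \<Longrightarrow> \<phi> (\<Sum>i\<in>I. weyl_scale (c i) (v i)) = (\<Sum>i\<in>I. c i * \<phi> (v i))"
proof (induction I rule: infinite_finite_induct)
  case empty
  then show ?case by (metis linear_form_def mult_zero_left sum.empty weyl1.scale_zero_left)
next
  case (infinite A)
  then show ?case by (metis linear_form_def mult_zero_left sum.infinite weyl1.scale_zero_left)
qed (simp_all add: linear_form_def)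

text \<open>Linear independence of \<open>x\<close>, encoded by coordinate forms defined on all of
  \<open>A_1\<close>.\<close>

definition dual_family :: "'i set \<Rightarrow> ('i \<Rightarrow> 'k::field weyl1) \<Rightarrow> ('i \<Rightarrow> 'k weyl1 \<Rightarrow> 'k) \<Rightarrow> bool"
  where "dual_family I x \<phi> \<longleftrightarrow>
    (\<forall>i\<in>I. linear_form (\<phi> i) \<and> (\<forall>j\<in>I. \<phi> i (x j) = (if j = i then 1 else 0)))"

text \<open>Contracting the left factors with \<open>\<phi> i\<close> isolates \<open>u i\<close>.
  With \<open>J = {}\<close> this says that a vanishing sum has vanishing coefficients.\<close>

lemma dual_family_tensor_left:
  assumes "finite I" "dual_family I x \<phi>" "i \<in> I"
    and "(\<Sum>j\<in>J. a j \<otimes> b j) = (\<Sum>j\<in>I. x j \<otimes> u j)"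
  shows "u i = (\<Sum>j\<in>J. weyl_scale (\<phi> i (a j)) (b j))"
proof -
  obtain f where f: "additive f" "\<And>a b. f (a \<otimes> b) = weyl_scale (\<phi> i a) b"
    using assms(2,3) tensor_contract_left[of "\<phi> i"] by (auto simp: dual_family_def)
  have "(\<Sum>j\<in>I. weyl_scale (\<phi> i (x j)) (u j)) = (\<Sum>j\<in>J. weyl_scale (\<phi> i (a j)) (b j))"
    using arg_cong[OF assms(4), of f] by (simp add: additive.sum[OF f(1)] f(2))
  moreover have "(\<Sum>j\<in>I. weyl_scale (\<phi> i (x j)) (u j)) = (\<Sum>j\<in>I. if j = i then u j else 0)"
    using assms(2,3) by (intro sum.cong) (auto simp: dual_family_def)
  ultimately show ?thesis using assms(1,3) by simp
qed

lemma dual_family_tensor_right: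
  assumes "finite I" "dual_family I y \<psi>" "i \<in> I"
    and "(\<Sum>j\<in>J. a j \<otimes> b j) = (\<Sum>j\<in>I. u j \<otimes> y j)"
  shows "u i = (\<Sum>j\<in>J. weyl_scale (\<psi> i (b j)) (a j))"
proof -
  obtain f where f: "additive f" "\<And>a b. f (a \<otimes> b) = weyl_scale (\<psi> i b) a"
    using assms(2,3) tensor_contract_right[of "\<psi> i"] by (auto simp: dual_family_def)
  have "(\<Sum>j\<in>I. weyl_scale (\<psi> i (y j)) (u j)) = (\<Sum>j\<in>J. weyl_scale (\<psi> i (b j)) (a j))"
    using arg_cong[OF assms(4), of f] by (simp add: additive.sum[OF f(1)] f(2))
  moreover have "(\<Sum>j\<in>I. weyl_scale (\<psi> i (y j)) (u j)) = (\<Sum>j\<in>I. if j = i then u j else 0)"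
    using assms(2,3) by (intro sum.cong) (auto simp: dual_family_def)
  ultimately show ?thesis using assms(1,3) by simp
qed

lemma weyl2_basis_expansion:
  assumes "weyl1.independent B" "weyl1.span B = UNIV"
  obtains S x where "finite S" "S \<subseteq> B" "w = (\<Sum>b\<in>S. x b \<otimes> b)"
proof -
  have "\<exists>S x. finite S \<and> S \<subseteq> B \<and> w = (\<Sum>b\<in>S. x b \<otimes> b)"
  proof (induction w rule: weyl2_induct)
    case (tensor a b)
    define r where "r = weyl1.representation B b"
    define S where "S = {c. r c \<noteq> 0}"
    have b: "b = (\<Sum>c\<in>S. weyl_scale (r c) c)"
      using weyl1.sum_nonzero_representation_eq[OF assms(1), of b] assms(2) by (simp add: r_def S_def)
    have "a \<otimes> b = (\<Sum>c\<in>S. weyl_scale (r c) a \<otimes> c)"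
      by (subst b) (simp add: tensor_sum_right tensor_scale)
    moreover have "finite S" "S \<subseteq> B"
      using weyl1.finite_representation weyl1.representation_ne_zero by (auto simp: r_def S_def)
    ultimately show ?case by (intro exI[of _ S] exI[of _ "\<lambda>c. weyl_scale (r c) a"]) simp
  next
    case (add u v)
    then obtain S x T y where S: "finite S" "S \<subseteq> B" "u = (\<Sum>b\<in>S. x b \<otimes> b)"
      and T: "finite T" "T \<subseteq> B" "v = (\<Sum>b\<in>T. y b \<otimes> b)" by blast
    \<comment> \<open>Both coefficient families are extended by 0 to the common index set.\<close>
    define t where "t = (\<lambda>b. (if b \<in> S then x b else 0) + (if b \<in> T then y b else 0))"
    have "u = (\<Sum>b\<in>S \<union> T. (if b \<in> S then x b else 0) \<otimes> b)"
      unfolding S(3) using S(1) T(1) by (intro sum.mono_neutral_cong_left) auto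
    moreover have "v = (\<Sum>b\<in>S \<union> T. (if b \<in> T then y b else 0) \<otimes> b)"
      unfolding T(3) using S(1) T(1) by (intro sum.mono_neutral_cong_left) auto
    ultimately have "u + v = (\<Sum>b\<in>S \<union> T. t b \<otimes> b)"
      unfolding t_def tensor_add_left sum.distrib by simp
    then show ?case using S T by (intro exI[of _ "S \<union> T"] exI[of _ t]) auto
  qed
  then show ?thesis using that by blast
qed

text \<open>Both families of tensor factors are chosen independent: the left factors form a basis of the
  span of the coordinates of \<open>w\<close> along a Hamel basis on the right.\<close>

lemma weyl2_reduced_representation:
  fixes w :: "'k::field weyl2"
  obtains I :: "'k weyl1 set" and x y \<phi> \<psi> where "finite I" "w = (\<Sum>i\<in>I. x i \<otimes> y i)"
    "dual_family I x \<phi>" "dual_family I y \<psi>"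
proof -
  define B :: "'k weyl1 set" where "B = weyl1.extend_basis {}"
  have B: "weyl1.independent B" "weyl1.span B = UNIV"
    unfolding B_def using weyl1.independent_empty
    by (rule weyl1.independent_extend_basis, rule weyl1.span_extend_basis)
  obtain S x where S: "finite S" "S \<subseteq> B" and w: "w = (\<Sum>b\<in>S. x b \<otimes> b)"
    using weyl2_basis_expansion[OF B] .
  obtain T where T: "T \<subseteq> x ` S" "weyl1.independent T" "x ` S \<subseteq> weyl1.span T"
    using weyl1.maximal_independent_subset[of "x ` S"] by blast
  have fT: "finite T" using T(1) S(1) finite_subset by blast
  \<comment> \<open>A full basis containing \<open>T\<close> turns coordinates along
    \<open>T\<close> into forms on the whole algebra.\<close>
  define E where "E = weyl1.extend_basis T"
  have E: "weyl1.independent E" "weyl1.span E = UNIV" "T \<subseteq> E"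
    unfolding E_def using T(2)
    by (rule weyl1.independent_extend_basis, rule weyl1.span_extend_basis,
        rule weyl1.extend_basis_superset)
  define r where "r b = weyl1.representation T (x b)" for b
  define y where "y t = (\<Sum>b\<in>S. weyl_scale (r b t) b)" for t
  have xb: "x b = (\<Sum>t\<in>T. weyl_scale (r b t) t)" if "b \<in> S" for b
    using weyl1.sum_representation_eq[OF T(2) _ fT order_refl, of "x b"] T(3) that by (auto simp: r_def)
  have "w = (\<Sum>b\<in>S. \<Sum>t\<in>T. t \<otimes> weyl_scale (r b t) b)"
    unfolding w by (intro sum.cong refl) (subst xb, simp_all add: tensor_sum_left tensor_scale)
  also have "\<dots> = (\<Sum>t\<in>T. t \<otimes> y t)"
    unfolding y_def tensor_sum_right by (rule sum.swap)
  finally have w': "w = (\<Sum>t\<in>T. t \<otimes> y t)" .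
  \<comment> \<open>Because \<open>T\<close> consists of coefficients of \<open>w\<close>, each
    \<open>t\<close> equals \<open>x (g t)\<close>. The coordinate of \<open>y t'\<close> at
    \<open>g t\<close> is thus the coordinate of \<open>t\<close> at \<open>t'\<close>, and reading
    off at \<open>g t\<close> is dual to \<open>y\<close>.\<close>
  have "\<forall>t\<in>T. \<exists>b. b \<in> S \<and> x b = t" using T(1) by blast
  from bchoice[OF this] obtain g where g: "\<And>t. t \<in> T \<Longrightarrow> g t \<in> S \<and> x (g t) = t"
    by blast
  have "dual_family T (\<lambda>t. t) (\<lambda>t a. weyl1.representation E a t)"
    using linear_form_representation[OF E(1,2)] weyl1.representation_basis[OF E(1)] E(3)
    by (auto simp: dual_family_def)
  moreover have "dual_family T y (\<lambda>t a. weyl1.representation B a (g t))"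
    unfolding dual_family_def
  proof (intro ballI conjI)
    fix t assume t: "t \<in> T"
    show lin: "linear_form (\<lambda>a. weyl1.representation B a (g t))"
      by (rule linear_form_representation[OF B])
    fix t' assume t': "t' \<in> T"
    have "weyl1.representation B (y t') (g t) = (\<Sum>b\<in>S. r b t' * weyl1.representation B b (g t))"
      unfolding y_def by (rule linear_form_sum[OF lin])
    also have "\<dots> = (\<Sum>b\<in>S. if b = g t then r b t' else 0)"
      using weyl1.representation_basis[OF B(1)] S(2) by (intro sum.cong) auto
    also have "\<dots> = r (g t) t'" using S(1) g[OF t] by simp
    also have "\<dots> = (if t' = t then 1 else 0)"
      using g[OF t] weyl1.representation_basis[OF T(2) t] by (simp add: r_def)
    finally show "weyl1.representation B (y t') (g t) = (if t' = t then 1 else 0)" .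
  qed
  ultimately show ?thesis by (rule that[OF fT w'])
qed

section \<open>Adjoint actions on tensors and the centralizer of the sum\<close>

lemma ad_tensor_left: "ad (z \<otimes> 1) (a \<otimes> b) = ad z a \<otimes> b"
  by (simp add: ad_def tensor_mult tensor_diff_left)

lemma ad_tensor_right: "ad (1 \<otimes> z) (a \<otimes> b) = a \<otimes> ad z b"
  by (simp add: ad_def tensor_mult tensor_diff_right)

lemma ad_funpow_tensor_left: "(ad (z \<otimes> 1) ^^ m) (a \<otimes> b) = (ad z ^^ m) a \<otimes> b"
  by (induction m) (simp_all add: ad_tensor_left)

lemma ad_funpow_tensor_right: "(ad (1 \<otimes> z) ^^ m) (a \<otimes> b) = a \<otimes> (ad z ^^ m) b"
  by (induction m) (simp_all add: ad_tensor_right)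

text \<open>\<open>ad u\<close> and \<open>ad v\<close> commute and are opposite on
  \<open>w\<close>, so their \<open>m\<close>-th iterates on \<open>w\<close> agree up to
  sign.\<close>

lemma ad_funpow_opposite:
  assumes "u * v = v * (u :: 'a::ring_1)" "ad (u + v) w = 0" "(ad u ^^ m) w = 0"
  shows "(ad v ^^ m) w = 0"
proof -
  have uv: "ad u (ad v x) = ad v (ad u x)" for x
  proof -
    have "u * (v * x) = v * (u * x)" "x * u * v = x * v * u"
      by (metis assms(1) mult.assoc)+
    then show ?thesis by (simp add: ad_def algebra_simps)
  qed
  have vm: "ad u ((ad v ^^ k) x) = (ad v ^^ k) (ad u x)" for k x
    by (induction k) (simp_all add: uv)
  have neg: "ad z (- x) = - ad z x" for z x :: 'a by (simp add: ad_def)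
  have negm: "(ad z ^^ k) (- x) = - (ad z ^^ k) x" for z x :: 'a and k
    by (induction k) (simp_all add: neg)
  have w: "ad u w = - ad v w" using assms(2) by (simp add: ad_def algebra_simps eq_neg_iff_add_eq_0)
  have "(ad u ^^ m) w = (ad v ^^ m) w \<or> (ad u ^^ m) w = - (ad v ^^ m) w"
    by (induction m) (auto simp: vm w neg negm simp flip: funpow_swap1)
  then show ?thesis using assms(3) by auto
qed

text \<open>Once both tensor factors lie in centralizers of nonscalar elements of
  \<open>A_1\<close>, products commute factor by factor.\<close>

lemma ad_C_weyl2_commutative:
  fixes z1 z2 :: "'k::field_char_0 weyl1"
  assumes "z1 \<notin> range weyl_scalar" "z2 \<notin> range weyl_scalar"
    and *: "\<And>w. w \<in> ad_C (z1 \<otimes> 1 + 1 \<otimes> z2) \<Longrightarrow>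
      \<exists>(I::'k weyl1 set) x y. w = (\<Sum>i\<in>I. x i \<otimes> y i) \<and> x ` I \<subseteq> ad_C z1 \<and> y ` I \<subseteq> ad_C z2"
    and "v \<in> ad_C (z1 \<otimes> 1 + 1 \<otimes> z2)" "w \<in> ad_C (z1 \<otimes> 1 + 1 \<otimes> z2)"
  shows "v * w = w * v"
proof -
  obtain I :: "'k weyl1 set" and x y where v: "v = (\<Sum>i\<in>I. x i \<otimes> y i)" "x ` I \<subseteq> ad_C z1" "y ` I \<subseteq> ad_C z2"
    using *[OF assms(4)] by blast
  obtain J :: "'k weyl1 set" and x' y' where w: "w = (\<Sum>i\<in>J. x' i \<otimes> y' i)" "x' ` J \<subseteq> ad_C z1" "y' ` J \<subseteq> ad_C z2"
    using *[OF assms(5)] by blast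
  have C: "a * b = b * a" if "z \<notin> range weyl_scalar" "a \<in> ad_C z" "b \<in> ad_C z" for a b z :: "'k weyl1"
    using that weyl_centralizer_commutative[of z a b] by (simp add: ad_C_def ad_def)
  have "x i * x' j = x' j * x i" "y i * y' j = y' j * y i" if "i \<in> I" "j \<in> J" for i j
    using that v w C[OF assms(1)] C[OF assms(2)] by (simp_all add: image_subset_iff)
  then have "v * w = (\<Sum>i\<in>I. \<Sum>j\<in>J. (x' j * x i) \<otimes> (y' j * y i))"
    unfolding v(1) w(1) sum_product tensor_mult by (intro sum.cong) auto
  also have "\<dots> = w * v"
    unfolding v(1) w(1) sum_product tensor_mult by (rule sum.swap)
  finally show ?thesis .
qed

theorem corollary6p11:
  fixes z1 z2 :: "'k::{alg_closed_field, field_char_0} weyl1"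
    and \<Gamma> :: "'k weyl2"
  assumes "z1 \<notin> range weyl_scalar"
    and "z2 \<notin> range weyl_scalar"
    and "\<Gamma> = z1 \<otimes> 1 + 1 \<otimes> z2"
  shows "(ad_nilpotent weyl_scale z1 \<and> ad_semisimple weyl_scale z2 \<longrightarrow>
            (\<forall>x\<in>ad_C \<Gamma>. \<forall>y\<in>ad_C \<Gamma>. x * y = y * x))
       \<and> (z1 \<in> Omega0' weyl_scale \<or> z2 \<in> Omega0' weyl_scale \<longrightarrow>
            (\<forall>x\<in>ad_C \<Gamma>. \<forall>y\<in>ad_C \<Gamma>. x * y = y * x))"
proof -
  have factors: "\<exists>(I::'k weyl1 set) x y. w = (\<Sum>i\<in>I. x i \<otimes> y i) \<and> x ` I \<subseteq> ad_C z1 \<and> y ` I \<subseteq> ad_C z2"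
    if types: "ad_nilpotent weyl_scale z1 \<and> ad_semisimple weyl_scale z2
        \<or> z1 \<in> Omega0' weyl_scale \<or> z2 \<in> Omega0' weyl_scale"
      and "w \<in> ad_C \<Gamma>" for w
  proof -
    have w0: "ad (z1 \<otimes> 1 + 1 \<otimes> z2) w = 0" using that(2) by (simp add: ad_C_def assms(3))
    obtain I :: "'k weyl1 set" and x y \<phi> \<psi> where I: "finite I" and w: "w = (\<Sum>i\<in>I. x i \<otimes> y i)"
      and dual: "dual_family I x \<phi>" "dual_family I y \<psi>"
      by (rule weyl2_reduced_representation)
    \<comment> \<open>The one relation is written twice, with signs on the left factors, so that
      contraction solves for \<open>ad z1 (x i)\<close> and for \<open>ad z2 (y i)\<close>.\<close>
    have xy: "(\<Sum>i\<in>I. (- x i) \<otimes> ad z2 (y i)) = (\<Sum>i\<in>I. ad z1 (x i) \<otimes> y i)"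
      and yx: "(\<Sum>i\<in>I. (- ad z1 (x i)) \<otimes> y i) = (\<Sum>i\<in>I. x i \<otimes> ad z2 (y i))"
    proof -
      have "ad (z1 \<otimes> 1) w + ad (1 \<otimes> z2) w = 0" using w0 by (simp add: ad_def algebra_simps)
      then have *: "(\<Sum>i\<in>I. ad z1 (x i) \<otimes> y i) + (\<Sum>i\<in>I. x i \<otimes> ad z2 (y i)) = 0"
        by (simp add: w ad_sum ad_tensor_left ad_tensor_right)
      have neg: "(- a) \<otimes> b = - (a \<otimes> b)" for a b :: "'k weyl1"
        using tensor_diff_left[of 0 a b] by simp
      show "(\<Sum>i\<in>I. (- x i) \<otimes> ad z2 (y i)) = (\<Sum>i\<in>I. ad z1 (x i) \<otimes> y i)"
        "(\<Sum>i\<in>I. (- ad z1 (x i)) \<otimes> y i) = (\<Sum>i\<in>I. x i \<otimes> ad z2 (y i))"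
        using * by (simp_all add: neg sum_negf eq_neg_iff_add_eq_0 neg_eq_iff_add_eq_0 add.commute)
    qed
    note x_eq = dual_family_tensor_right[OF I dual(2) _ xy]
    note y_eq = dual_family_tensor_left[OF I dual(1) _ yx]
    have xF: "x ` I \<subseteq> ad_F weyl_scale z1"
    proof (rule subset_ad_F)
      show "ad z1 b \<in> weyl1.span (x ` I)" if "b \<in> x ` I" for b
        using that by (auto simp: x_eq intro!: weyl1.span_sum weyl1.span_scale weyl1.span_neg
            weyl1.span_base[OF imageI])
    qed (simp add: I)
    have yF: "y ` I \<subseteq> ad_F weyl_scale z2"
    proof (rule subset_ad_F)
      show "ad z2 b \<in> weyl1.span (y ` I)" if "b \<in> y ` I" for b
        using that by (auto simp: y_eq intro!: weyl1.span_sum weyl1.span_scale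
            weyl1.span_base[OF imageI])
    qed (simp add: I)
    have x_imp_y: "y ` I \<subseteq> ad_C z2" if "x ` I \<subseteq> ad_C z1"
    proof -
      \<comment> \<open>The left side of \<open>yx\<close> vanishes and is read as the sum over
        \<open>J = {}\<close>.\<close>
      have "ad z2 (y i) = 0" if "i \<in> I" for i
        using dual_family_tensor_left[OF I dual(1) that, where J = "{}" and u = "\<lambda>i. ad z2 (y i)"] yx
          \<open>x ` I \<subseteq> ad_C z1\<close> by (simp add: ad_C_def image_subset_iff)
      then show ?thesis by (auto simp: ad_C_def)
    qed
    have y_imp_x: "x ` I \<subseteq> ad_C z1" if "y ` I \<subseteq> ad_C z2"
    proof -
      have "ad z1 (x i) = 0" if "i \<in> I" for i
        using dual_family_tensor_right[OF I dual(2) that, where J = "{}" and u = "\<lambda>i. ad z1 (x i)"] xy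
          \<open>y ` I \<subseteq> ad_C z2\<close> by (simp add: ad_C_def image_subset_iff)
      then show ?thesis by (auto simp: ad_C_def)
    qed
    have nil_semi: "y ` I \<subseteq> ad_C z2" if "ad_nilpotent weyl_scale z1" "ad_semisimple weyl_scale z2"
    proof -
      have "ad_Ev weyl_scale z1 = {0}" using that(1) by (auto simp: ad_nilpotent_def Omega1_def Omega1'_def)
      then have "x ` I \<subseteq> ad_N z1" using xF ad_F_subset_ad_N by blast
      then have "\<forall>i\<in>I. \<exists>m. (ad z1 ^^ m) (x i) = 0" by (auto simp: ad_N_def)
      then obtain m where m: "\<And>i. i \<in> I \<Longrightarrow> (ad z1 ^^ m i) (x i) = 0" by metis
      \<comment> \<open>The sum bounds every \<open>m i\<close>, giving one exponent for all
        \<open>x i\<close>.\<close>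
      define M where "M = (\<Sum>i\<in>I. m i)"
      have M: "(ad z1 ^^ M) (x i) = 0" if "i \<in> I" for i
      proof -
        have "m i \<le> M" using that I by (auto simp: M_def intro: member_le_sum)
        then have "(ad z1 ^^ M) (x i) = (ad z1 ^^ (M - m i)) ((ad z1 ^^ m i) (x i))"
          by (simp flip: funpow_add comp_apply[of "ad z1 ^^ (M - m i)"])
        moreover have "(ad z1 ^^ k) 0 = 0" for k by (induction k) simp_all
        ultimately show ?thesis using m[OF that] by simp
      qed
      have "(ad (z1 \<otimes> 1) ^^ M) w = 0"
        by (simp add: w ad_funpow_sum ad_funpow_tensor_left M)
      \<comment> \<open>Nilpotency on \<open>w\<close> passes from the first tensor factor to the
        second; independence of the \<open>x i\<close> then carries it to each
        \<open>y i\<close>.\<close>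
      then have "(ad (1 \<otimes> z2) ^^ M) w = 0"
        by (intro ad_funpow_opposite[of "z1 \<otimes> 1" "1 \<otimes> z2"] w0) (simp_all add: tensor_mult)
      then have "(\<Sum>i\<in>I. x i \<otimes> (ad z2 ^^ M) (y i)) = 0"
        by (simp add: w ad_funpow_sum ad_funpow_tensor_right)
      then have "(ad z2 ^^ M) (y i) = 0" if "i \<in> I" for i
        using dual_family_tensor_left[OF I dual(1) that, where J = "{}" and u = "\<lambda>i. (ad z2 ^^ M) (y i)"] by simp
      then have "y ` I \<subseteq> ad_N z2" by (auto simp: ad_N_def)
      moreover have "ad_F weyl_scale z2 = ad_D weyl_scale z2"
        using that(2) by (auto simp: ad_semisimple_def Omega2_def Omega2'_def)
      ultimately show ?thesis using yF ad_D_inter_ad_N_subset_ad_C by blast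
    qed
    have "x ` I \<subseteq> ad_C z1 \<or> y ` I \<subseteq> ad_C z2"
      using types
    proof (elim disjE)
      assume "z1 \<in> Omega0' weyl_scale"
      then have "ad_C z1 = ad_F weyl_scale z1" unfolding Omega0'_def by blast
      then show ?thesis using xF by blast
    next
      assume "z2 \<in> Omega0' weyl_scale"
      then have "ad_C z2 = ad_F weyl_scale z2" unfolding Omega0'_def by blast
      then show ?thesis using yF by blast
    qed (use nil_semi in blast)
    then have "x ` I \<subseteq> ad_C z1 \<and> y ` I \<subseteq> ad_C z2" using x_imp_y y_imp_x by blast
    then show ?thesis using w by blast
  qed
  have "v * w = w * v"
    if types: "ad_nilpotent weyl_scale z1 \<and> ad_semisimple weyl_scale z2
        \<or> z1 \<in> Omega0' weyl_scale \<or> z2 \<in> Omega0' weyl_scale"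
      and "v \<in> ad_C \<Gamma>" "w \<in> ad_C \<Gamma>" for v w
    using factors[OF types, unfolded assms(3)] that(2,3)[unfolded assms(3)]
    by (rule ad_C_weyl2_commutative[OF assms(1,2)])
  then show ?thesis by simp
qed

end
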